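(* Let $\Omega\subset\mathbb{R}^n$ be open, $n\ge2$, $p\ge2$, let $f:\Omega\times\mathbb{R}\to(0,\infty)$ be a positive function satisfying (F1) and (F2), and such that for every $x\in\Omega$ the map $s\mapsto f(x,s)$ is non-increasing. Let $u,v\in W^{1,\infty}_{loc}(\Omega)$ be local weak solutions of $$-\operatorname{div}\Big((|Du|-1)_+^{p-1}\frac{Du}{|Du|}\Big)=f(x,u)\quad\text{in }\Omega .$$ If $\Omega'\Subset\Omega$ is open and $u\le v$ on $\partial\Omega'$ (in the sense that $(u-v)_+\in W^{1,p}_0(\Omega')$), then $u\le v$ a.e. in $\Omega'$. Moreover, if $\{x\in\Omega: |Du(x)|\le1\}$ is contained in a compact subset of $\Omega$ (and $u\le v$ on $\partial\Omega$ in the sense $(u-v)_+\in W^{1,p}_0(\Omega)$, with the weak formulation for $u$ and $v$ valid for test functions in $W^{1,p}_0(\Omega)$), then one may take $\Omega'=\Omega$, i.e. $u\le v$ a.e. in $\Omega$.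
   Context: $(s)_+=\max\{s,0\}$. For $\gamma>0$, $H_\gamma:\mathbb{R}^n\to\mathbb{R}^n$ is defined by $H_\gamma(\xi)=(|\xi|-1)_+^{\gamma}\frac{\xi}{|\xi|}$ for $\xi\ne0$, $H_\gamma(0)=0$. Assumptions on $f$: for every open set $\Omega'\Subset\Omega$ and every $K>0$ there exist constants $L,M>0$ such that (F1) $|f(x,s)-f(x,t)|\le L|s-t|$ and (F2) $|f(x,s)-f(y,s)|\le M|x-y|$ for all $x,y\in\Omega'$ and all $s,t\in\mathbb{R}$ with $|s|,|t|\le K$. A function $u\in W^{1,p}_{loc}(\Omega)$ is a local weak solution of the equation if for every open $\tilde\Omega\Subset\Omega$ and every $\varphi\in W^{1,p}_0(\tilde\Omega)$, $\int_\Omega\langle H_{p-1}(Du),D\varphi\rangle\,dx=\int_\Omega f(x,u)\varphi\,dx$. *)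

theory Defs
  imports "HOL-Analysis.Analysis"
begin

(* Functions on R^n are modelled as functions on real^'n; only values on the
   relevant open set matter. *)

definition Hg :: "real \<Rightarrow> real^'n \<Rightarrow> real^'n" where
  "Hg \<gamma> \<xi> = (if \<xi> = 0 then 0 else (max (norm \<xi> - 1) 0 powr \<gamma>) *\<^sub>R (\<xi> /\<^sub>R norm \<xi>))"

definition pderiv_i :: "'n \<Rightarrow> (real^'n \<Rightarrow> real) \<Rightarrow> real^'n \<Rightarrow> real" where
  "pderiv_i i \<phi> x = frechet_derivative \<phi> (at x) (axis i 1)"

definition cgrad :: "(real^'n \<Rightarrow> real) \<Rightarrow> real^'n \<Rightarrow> real^'n" where
  "cgrad \<phi> x = (\<chi> i. pderiv_i i \<phi> x)"

fun Ck :: "nat \<Rightarrow> (real^'n \<Rightarrow> real) \<Rightarrow> bool" where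
  "Ck 0 \<phi> = continuous_on UNIV \<phi>"
| "Ck (Suc k) \<phi> = (continuous_on UNIV \<phi> \<and> (\<forall>x. \<phi> differentiable (at x)) \<and>
                     (\<forall>i. Ck k (pderiv_i i \<phi>)))"

definition smooth_fun :: "(real^'n \<Rightarrow> real) \<Rightarrow> bool" where
  "smooth_fun \<phi> \<longleftrightarrow> (\<forall>k. Ck k \<phi>)"

definition test_fun :: "(real^'n) set \<Rightarrow> (real^'n \<Rightarrow> real) \<Rightarrow> bool" where
  "test_fun U \<phi> \<longleftrightarrow> smooth_fun \<phi> \<and> compact (closure {x. \<phi> x \<noteq> 0}) \<and>
                     closure {x. \<phi> x \<noteq> 0} \<subseteq> U"

definition weak_grad :: "(real^'n) set \<Rightarrow> (real^'n \<Rightarrow> real) \<Rightarrow> (real^'n \<Rightarrow> real^'n) \<Rightarrow> bool" where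
  "weak_grad U u g \<longleftrightarrow>
     (\<forall>K. compact K \<and> K \<subseteq> U \<longrightarrow> set_integrable lebesgue K u \<and>
            (\<forall>i. set_integrable lebesgue K (\<lambda>x. g x $ i))) \<and>
     (\<forall>\<phi> i. test_fun U \<phi> \<longrightarrow>
        (LINT x:U|lebesgue. u x * cgrad \<phi> x $ i) = - (LINT x:U|lebesgue. g x $ i * \<phi> x))"

definition Lp_on :: "real \<Rightarrow> (real^'n) set \<Rightarrow> (real^'n \<Rightarrow> real) \<Rightarrow> bool" where
  "Lp_on p U w \<longleftrightarrow> set_borel_measurable lebesgue U w \<and>
                    set_integrable lebesgue U (\<lambda>x. \<bar>w x\<bar> powr p)"

definition W1p :: "real \<Rightarrow> (real^'n) set \<Rightarrow> (real^'n \<Rightarrow> real) \<Rightarrow> (real^'n \<Rightarrow> real^'n) \<Rightarrow> bool" where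
  "W1p p U w g \<longleftrightarrow> weak_grad U w g \<and> Lp_on p U w \<and>
                    set_borel_measurable lebesgue U g \<and> Lp_on p U (\<lambda>x. norm (g x))"

definition W01p :: "real \<Rightarrow> (real^'n) set \<Rightarrow> (real^'n \<Rightarrow> real) \<Rightarrow> (real^'n \<Rightarrow> real^'n) \<Rightarrow> bool" where
  "W01p p U w g \<longleftrightarrow> W1p p U w g \<and>
     (\<exists>\<phi>s. (\<forall>k. test_fun U (\<phi>s k)) \<and>
        (\<lambda>k. LINT x:U|lebesgue. \<bar>\<phi>s k x - w x\<bar> powr p + norm (cgrad (\<phi>s k) x - g x) powr p)
          \<longlonglongrightarrow> 0)"

definition W1inf_loc :: "(real^'n) set \<Rightarrow> (real^'n \<Rightarrow> real) \<Rightarrow> (real^'n \<Rightarrow> real^'n) \<Rightarrow> bool" where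
  "W1inf_loc U w g \<longleftrightarrow> weak_grad U w g \<and>
     set_borel_measurable lebesgue U w \<and> set_borel_measurable lebesgue U g \<and>
     (\<forall>K. compact K \<and> K \<subseteq> U \<longrightarrow>
        (\<exists>C. AE x in lebesgue. x \<in> K \<longrightarrow> \<bar>w x\<bar> \<le> C \<and> norm (g x) \<le> C))"

definition cpt_sub :: "(real^'n) set \<Rightarrow> (real^'n) set \<Rightarrow> bool" where
  "cpt_sub V U \<longleftrightarrow> compact (closure V) \<and> closure V \<subseteq> U"

(* local weak solution of -div H_{p-1}(Du) = f(x,u) in \<Omega>, Du the weak gradient of u *)
definition loc_weak_sol ::
  "real \<Rightarrow> (real^'n) set \<Rightarrow> (real^'n \<Rightarrow> real \<Rightarrow> real) \<Rightarrow> (real^'n \<Rightarrow> real) \<Rightarrow> (real^'n \<Rightarrow> real^'n) \<Rightarrow> bool" where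
  "loc_weak_sol p \<Omega> f u Du \<longleftrightarrow>
     (\<forall>V \<phi> D\<phi>. open V \<and> cpt_sub V \<Omega> \<and> W01p p V \<phi> D\<phi> \<longrightarrow>
        (LINT x:V|lebesgue. inner (Hg (p - 1) (Du x)) (D\<phi> x)) =
        (LINT x:V|lebesgue. f x (u x) * \<phi> x))"

definition glob_weak_sol ::
  "real \<Rightarrow> (real^'n) set \<Rightarrow> (real^'n \<Rightarrow> real \<Rightarrow> real) \<Rightarrow> (real^'n \<Rightarrow> real) \<Rightarrow> (real^'n \<Rightarrow> real^'n) \<Rightarrow> bool" where
  "glob_weak_sol p \<Omega> f u Du \<longleftrightarrow>
     (\<forall>\<phi> D\<phi>. W01p p \<Omega> \<phi> D\<phi> \<longrightarrow>
        set_integrable lebesgue \<Omega> (\<lambda>x. inner (Hg (p - 1) (Du x)) (D\<phi> x)) \<and>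
        set_integrable lebesgue \<Omega> (\<lambda>x. f x (u x) * \<phi> x) \<and>
        (LINT x:\<Omega>|lebesgue. inner (Hg (p - 1) (Du x)) (D\<phi> x)) =
        (LINT x:\<Omega>|lebesgue. f x (u x) * \<phi> x))"

definition F1F2 :: "(real^'n) set \<Rightarrow> (real^'n \<Rightarrow> real \<Rightarrow> real) \<Rightarrow> bool" where
  "F1F2 \<Omega> f \<longleftrightarrow>
    (\<forall>\<Omega>' K. open \<Omega>' \<and> cpt_sub \<Omega>' \<Omega> \<and> K > 0 \<longrightarrow>
       (\<exists>L M. L > 0 \<and> M > 0 \<and>
          (\<forall>x\<in>\<Omega>'. \<forall>y\<in>\<Omega>'. \<forall>s t. \<bar>s\<bar> \<le> K \<and> \<bar>t\<bar> \<le> K \<longrightarrow>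
              \<bar>f x s - f x t\<bar> \<le> L * \<bar>s - t\<bar> \<and> \<bar>f x s - f y s\<bar> \<le> M * norm (x - y))))"

end

theory Submission
  imports Defs
begin

text \<open>Let \<open>w = (u - v)\<^sub>+\<close>. Its weak gradient is \<open>Du - Dv\<close> a.e. on \<open>{u > v}\<close> and \<open>0\<close> elsewhere. Testing both
  equations with \<open>w\<close> and subtracting, monotonicity of \<open>f\<close> gives \<open>\<integral> \<langle>H(Du) - H(Dv), Dw\<rangle> \<le> 0\<close>, while the
  integrand is nonnegative by monotonicity of \<open>H\<close>. Hence it vanishes, so a.e. on \<open>{u > v}\<close> either
  \<open>Du = Dv\<close> or \<open>\<bar>Du\<bar> \<le> 1\<close>. In both cases \<open>\<langle>H(Du), Dw\<rangle> = 0\<close>, and the equation for \<open>u\<close> tested with \<open>w\<close>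
  leaves \<open>\<integral> f(x, u) w = 0\<close>. As \<open>f > 0\<close>, \<open>w = 0\<close> a.e.\<close>

section \<open>Smooth bump functions\<close>


text \<open>The gradient \<open>g\<close> of the positive part is known only through
  \<open>W01p\<close>, that is, as an L^p limit of gradients of test functions. Identifying it takes
  most of the work. Neither \<open>u\<close> nor \<open>v\<close> is mollified: classical calculus
  is applied only to the test functions approximating \<open>w\<close>, while \<open>u - v\<close>
  enters through its weak gradient tested with products of test functions. Since p \<ge> 2, L^p
  convergence implies L^2 convergence on compact sets, so products pass to the limit by Young's
  inequality alone. A second obstacle is that the Bochner integral of a nonintegrable function is 0,
  so equality of two integrals does not by itself permit subtraction of the equations. For compactly
  contained sets, integrability comes from the local bounds on \<open>u\<close> and
  \<open>Du\<close> and the continuity of \<open>f\<close>; in the global case it is part of the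
  weak formulation.\<close>

lemma pderiv_i_eq:
  assumes "(\<phi> has_derivative \<phi>') (at x)"
  shows "pderiv_i i \<phi> x = \<phi>' (axis i 1)"
  using frechet_derivative_at[OF assms] by (simp add: pderiv_i_def)

lemma differentiable_has_frechet_derivative:
  "\<phi> differentiable (at x) \<Longrightarrow> (\<phi> has_derivative frechet_derivative \<phi> (at x)) (at x)"
  by (simp add: frechet_derivative_works)

lemma Ck_continuous: "Ck k \<phi> \<Longrightarrow> continuous_on UNIV \<phi>"
  by (cases k) auto

text \<open>Serves the product rule: Leibniz's formula pairs a derivative of one factor with the
  other factor undifferentiated, so the latter has to be lowered by one order.\<close>

lemma Ck_Suc_imp: "Ck (Suc k) \<phi> \<Longrightarrow> Ck k \<phi>"
proof (induction k arbitrary: \<phi>)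
  case (Suc k)
  have "Ck k (pderiv_i i \<phi>)" for i
    using Suc.prems by (intro Suc.IH) simp
  with Suc.prems show ?case by simp
qed simp

lemma pderiv_i_add:
  assumes "\<phi> differentiable (at x)" "\<psi> differentiable (at x)"
  shows "pderiv_i i (\<lambda>x. \<phi> x + \<psi> x) x = pderiv_i i \<phi> x + pderiv_i i \<psi> x"
  by (subst pderiv_i_eq[OF has_derivative_add[OF
        differentiable_has_frechet_derivative[OF assms(1)]
        differentiable_has_frechet_derivative[OF assms(2)]]])
     (simp add: pderiv_i_def)

lemma pderiv_i_mult:
  assumes "\<phi> differentiable (at x)" "\<psi> differentiable (at x)"
  shows "pderiv_i i (\<lambda>x. \<phi> x * \<psi> x) x = \<phi> x * pderiv_i i \<psi> x + pderiv_i i \<phi> x * \<psi> x"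
  by (subst pderiv_i_eq[OF has_derivative_mult[OF
        differentiable_has_frechet_derivative[OF assms(1)]
        differentiable_has_frechet_derivative[OF assms(2)]]])
     (simp add: pderiv_i_def)

lemma Ck_add: "Ck k \<phi> \<Longrightarrow> Ck k \<psi> \<Longrightarrow> Ck k (\<lambda>x. \<phi> x + \<psi> x)"
proof (induction k arbitrary: \<phi> \<psi>)
  case (Suc k)
  have "pderiv_i i (\<lambda>x. \<phi> x + \<psi> x) = (\<lambda>x. pderiv_i i \<phi> x + pderiv_i i \<psi> x)" for i
    using Suc.prems by (intro ext pderiv_i_add) auto
  with Suc show ?case
    by (auto intro!: continuous_intros differentiable_add)
qed (auto intro: continuous_intros)

lemma Ck_mult: "Ck k \<phi> \<Longrightarrow> Ck k \<psi> \<Longrightarrow> Ck k (\<lambda>x. \<phi> x * \<psi> x)"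
proof (induction k arbitrary: \<phi> \<psi>)
  case (Suc k)
  have "pderiv_i i (\<lambda>x. \<phi> x * \<psi> x) = (\<lambda>x. \<phi> x * pderiv_i i \<psi> x + pderiv_i i \<phi> x * \<psi> x)" for i
    using Suc.prems by (intro ext pderiv_i_mult) auto
  moreover have "Ck k (\<lambda>x. \<phi> x * pderiv_i i \<psi> x + pderiv_i i \<phi> x * \<psi> x)" for i
    using Suc.prems Ck_Suc_imp[of k \<phi>] Ck_Suc_imp[of k \<psi>] by (intro Ck_add Suc.IH) auto
  ultimately show ?case
    using Suc.prems by (auto intro!: continuous_intros differentiable_mult)
qed (auto intro: continuous_intros)

lemma Ck_const: "Ck k (\<lambda>x. c)"
proof (induction k arbitrary: c)
  case (Suc k)
  have "pderiv_i i (\<lambda>x. c) = (\<lambda>x. 0)" for i :: 'a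
    by (intro ext) (subst pderiv_i_eq[OF has_derivative_const], simp)
  with Suc show ?case by simp
qed simp

lemma Ck_prod:
  assumes "finite I" "\<And>i. i \<in> I \<Longrightarrow> Ck k (\<phi> i)"
  shows "Ck k (\<lambda>x. \<Prod>i\<in>I. \<phi> i x)"
  using assms by (induction I rule: finite_induct) (auto intro: Ck_const Ck_mult)

text \<open>The derivatives of \<open>exp (-1/t)\<close>, extended by \<open>0\<close> to \<open>t \<le> 0\<close>, are linear combinations of these functions.\<close>

definition flat :: "nat \<Rightarrow> real \<Rightarrow> real" where
  "flat m t = (if t > 0 then exp (- 1 / t) / t ^ m else 0)"

text \<open>With s = 1/t this is the growth of exp s beyond every power of s.\<close>

lemma flat_tendsto_0: "(flat m \<longlongrightarrow> 0) (at_right 0)"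
proof -
  have "((\<lambda>s::real. s ^ m / exp s) \<longlongrightarrow> 0) at_top"
    by (rule tendsto_power_div_exp_0)
  then have "((\<lambda>t::real. inverse t ^ m / exp (inverse t)) \<longlongrightarrow> 0) (at_right 0)"
    by (rule filterlim_compose[OF _ filterlim_inverse_at_top_right])
  then show ?thesis
    by (rule Lim_transform_eventually)
       (auto simp: eventually_at_filter flat_def exp_minus field_simps)
qed

lemma DERIV_flat: "(flat m has_real_derivative flat (m + 2) t - real m * flat (m + 1) t) (at t)"
proof -
  consider "t > 0" | "t < 0" | "t = 0" by linarith
  then show ?thesis
  proof cases
    case 1
    have "((\<lambda>t. exp (- 1 / t) / t ^ m) has_real_derivative flat (m + 2) t - real m * flat (m + 1) t) (at t)"
      using 1
      apply (auto intro!: derivative_eq_intros simp: flat_def)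
      apply (cases m)
       apply (auto simp: field_simps power2_eq_square)
      done
    then show ?thesis
      by (rule has_field_derivative_transform_within_open[where S="{0<..}"]) (use 1 in \<open>auto simp: flat_def\<close>)
  next
    case 2
    have "((\<lambda>t. 0) has_real_derivative flat (m + 2) t - real m * flat (m + 1) t) (at t)"
      using 2 by (simp add: flat_def)
    then show ?thesis
      by (rule has_field_derivative_transform_within_open[where S="{..<0}"]) (use 2 in \<open>auto simp: flat_def\<close>)
  next
    case 3
    have "((\<lambda>h. (flat m h - flat m 0) / h) \<longlongrightarrow> 0) (at_left 0)"
      by (rule tendsto_eventually) (auto simp: eventually_at_filter flat_def)
    \<comment> \<open>For h > 0 the difference quotient at the origin is itself
      \<open>flat (Suc m) h\<close>.\<close>
    moreover have "((\<lambda>h. (flat m h - flat m 0) / h) \<longlongrightarrow> 0) (at_right 0)"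
      by (rule Lim_transform_eventually[OF flat_tendsto_0[of "Suc m"]])
         (auto simp: eventually_at_filter flat_def)
    ultimately have "((\<lambda>h. (flat m h - flat m 0) / h) \<longlongrightarrow> 0) (at 0)"
      by (simp add: filterlim_split_at)
    then show ?thesis
      using 3 by (simp add: DERIV_def flat_def)
  qed
qed

text \<open>The induction closes because \<open>m\<close> is arbitrary: one derivative leads to
  indices m + 1 and m + 2. The affine argument allows both signs of \<open>c\<close>, hence both
  faces of a box in direction \<open>i\<close>.\<close>

lemma Ck_flat: "Ck k (\<lambda>x. flat m (c * x $ i + a))"
proof (induction k arbitrary: m)
  case 0
  have "continuous_on UNIV (flat m)"
    by (rule DERIV_continuous_on) (rule has_field_derivative_at_within[OF DERIV_flat])
  then have "continuous_on UNIV (\<lambda>x. flat m (c * x $ i + a))"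
    by (rule continuous_on_compose2) (auto intro!: continuous_intros)
  then show ?case by simp
next
  case (Suc k)
  have D: "((\<lambda>x. flat m (c * x $ i + a)) has_derivative
      (\<lambda>h. (flat (m + 2) (c * x $ i + a) - real m * flat (m + 1) (c * x $ i + a)) * (c * h $ i))) (at x)" for x
    by (rule has_derivative_compose[OF _ DERIV_flat[unfolded has_field_derivative_def]])
       (auto intro!: derivative_eq_intros bounded_linear.has_derivative[OF bounded_linear_vec_nth])
  have eq: "pderiv_i j (\<lambda>x. flat m (c * x $ i + a)) =
      (\<lambda>x. (c * axis j 1 $ i) * (flat (m + 2) (c * x $ i + a) + (- real m) * flat (m + 1) (c * x $ i + a)))" for j
    by (intro ext) (subst pderiv_i_eq[OF D], simp)
  have "Ck k (pderiv_i j (\<lambda>x. flat m (c * x $ i + a)))" for j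
    unfolding eq by (intro Ck_mult Ck_const Ck_add Suc.IH)
  moreover have "(\<lambda>x. flat m (c * x $ i + a)) differentiable (at x)" for x
    using D by (rule differentiableI)
  ultimately show ?case
    using Ck_continuous[OF Suc.IH] by simp
qed

text \<open>A smooth approximation of the indicator of \<open>box a b\<close> from below. The
  arguments are scaled instead of the box: all members live on the same box, and each factor exp (-1
  / ((k + 1) d)) tends to 1 at any distance d > 0 from a face.\<close>

definition bump :: "nat \<Rightarrow> real^'n \<Rightarrow> real^'n \<Rightarrow> real^'n \<Rightarrow> real" where
  "bump k a b x = (\<Prod>i\<in>UNIV. flat 0 (real (Suc k) * (x $ i - a $ i)) * flat 0 (real (Suc k) * (b $ i - x $ i)))"

lemma bump_outside: "x \<notin> box a b \<Longrightarrow> bump k a b x = 0"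
proof -
  assume "x \<notin> box a b"
  then obtain i where "x $ i \<le> a $ i \<or> b $ i \<le> x $ i"
    unfolding mem_box_cart by (meson not_le)
  then have "flat 0 (real (Suc k) * (x $ i - a $ i)) * flat 0 (real (Suc k) * (b $ i - x $ i)) = 0"
    by (auto simp: flat_def zero_less_mult_iff)
  then show ?thesis unfolding bump_def by (intro prod_zero) auto
qed

lemma flat_range: "0 \<le> flat 0 t" "flat 0 t \<le> 1"
  by (auto simp: flat_def)

lemma bump_range: "0 \<le> bump k a b x" "bump k a b x \<le> 1"
  unfolding bump_def
   apply (rule prod_nonneg)
   apply (simp add: flat_range)
  apply (rule prod_le_1)
  apply (simp add: flat_range mult_le_one)
  done

lemma bump_tendsto:
  assumes "x \<in> box a b"
  shows "(\<lambda>k. bump k a b x) \<longlonglongrightarrow> 1"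
proof -
  have *: "(\<lambda>k. flat 0 (real (Suc k) * d)) \<longlonglongrightarrow> 1" if "d > 0" for d
  proof -
    have "(\<lambda>k. exp (- (inverse (real (Suc k)) * (1 / d)))) \<longlonglongrightarrow> exp (- (0 * (1 / d)))"
      by (intro tendsto_intros LIMSEQ_inverse_real_of_nat)
    moreover have "0 < d + d * real k" for k
      using that by (simp add: add_pos_nonneg)
    ultimately show ?thesis by (simp add: flat_def field_simps)
  qed
  have "(\<lambda>k. \<Prod>i\<in>UNIV. flat 0 (real (Suc k) * (x $ i - a $ i)) * flat 0 (real (Suc k) * (b $ i - x $ i)))
     \<longlonglongrightarrow> (\<Prod>i\<in>(UNIV::'a set). 1 * 1)"
    using assms by (intro tendsto_prod tendsto_mult *) (auto simp: mem_box_cart)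
  then show ?thesis by (simp add: bump_def)
qed

lemma test_fun_bump:
  assumes "cbox a b \<subseteq> U"
  shows "test_fun U (bump k a b)"
proof -
  have "Ck m (bump k a b)" for m
  proof -
    have eq: "real (Suc k) * (s - t) = real (Suc k) * s + - (real (Suc k) * t)"
      "real (Suc k) * (s - t) = - real (Suc k) * t + real (Suc k) * s" for s t
      by (simp_all add: algebra_simps)
    have "Ck m (\<lambda>x. flat 0 (real (Suc k) * (x $ i - a $ i)))" for i
      unfolding eq(1) by (rule Ck_flat)
    moreover have "Ck m (\<lambda>x. flat 0 (real (Suc k) * (b $ i - x $ i)))" for i
      unfolding eq(2) by (rule Ck_flat)
    ultimately show ?thesis
      unfolding bump_def by (intro Ck_prod Ck_mult) auto
  qed
  moreover have *: "closure {x. bump k a b x \<noteq> 0} \<subseteq> cbox a b"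
    using bump_outside box_subset_cbox by (intro closure_minimal) (auto, blast)
  moreover have "compact (closure {x. bump k a b x \<noteq> 0})"
    using * by (meson bounded_cbox bounded_subset closed_closure compact_eq_bounded_closed)
  ultimately show ?thesis
    using assms unfolding test_fun_def smooth_fun_def by blast
qed

section \<open>The fundamental lemma of the calculus of variations\<close>


lemma sigma_finite_measure_lebesgue: "sigma_finite_measure (lebesgue :: 'a::euclidean_space measure)"
proof
  obtain A :: "'a set set" where A: "countable A" "A \<subseteq> sets lborel" "\<Union>A = space lborel" "\<forall>a\<in>A. emeasure lborel a \<noteq> \<infinity>"
    using lborel.sigma_finite_countable by blast
  then show "\<exists>A :: 'a set set. countable A \<and> A \<subseteq> sets lebesgue \<and> \<Union>A = space lebesgue \<and> (\<forall>a\<in>A. emeasure lebesgue a \<noteq> \<infinity>)"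
    by (intro exI[of _ A]) (auto simp: subset_iff)
qed

text \<open>A Dynkin argument: open boxes form an intersection-stable generator of the Borel sets,
  and the sets over which \<open>h\<close> integrates to 0 are closed under complements and
  countable disjoint unions. Vanishing of all set integrals then forces \<open>h\<close> to vanish
  almost everywhere.\<close>

lemma AE_zero_if_box_integrals_zero:
  fixes h :: "'a::euclidean_space \<Rightarrow> real"
  assumes int: "integrable lebesgue h" and zero: "\<And>a b. (LINT x:box a b|lebesgue. h x) = 0"
  shows "AE x in lebesgue. h x = 0"
proof (rule sigma_finite_measure.density_zero[OF sigma_finite_measure_lebesgue int])
  have sint: "set_integrable lebesgue A h" if "A \<in> sets lebesgue" for A
    unfolding set_integrable_def using int that by (rule integrable_mult_indicator[rotated])
  \<comment> \<open>Passing to complements requires the integral over the whole space, which is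
    exhausted by growing boxes.\<close>
  have UNIV: "(LINT x:UNIV|lebesgue. h x) = 0"
  proof -
    have "(\<lambda>n::nat. LINT x|lebesgue. indicator (box (- (real n *\<^sub>R One)) (real n *\<^sub>R One)) x *\<^sub>R h x)
        \<longlonglongrightarrow> (LINT x|lebesgue. indicator UNIV x *\<^sub>R h x)"
    proof (rule integral_dominated_convergence[where w="\<lambda>x. norm (h x)"])
      show "AE x in lebesgue. (\<lambda>n. indicator (box (- (real n *\<^sub>R One)) (real n *\<^sub>R One)) x *\<^sub>R h x)
          \<longlonglongrightarrow> indicator UNIV x *\<^sub>R h x"
      proof (rule always_eventually, rule allI, rule tendsto_eventually)
        fix x :: 'a
        obtain n where n: "\<And>i. i \<in> Basis \<Longrightarrow> \<bar>x \<bullet> i\<bar> < real n"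
          using reals_Archimedean2[of "norm x"] Basis_le_norm[of _ x] by (metis le_less_trans)
        have "x \<in> box (- (real m *\<^sub>R One)) (real m *\<^sub>R One)" if "m \<ge> n" for m
        proof -
          have "\<bar>x \<bullet> i\<bar> < real m" if "i \<in> Basis" for i
            using n[OF that] \<open>m \<ge> n\<close> by linarith
          then show ?thesis by (auto simp: mem_box abs_less_iff minus_less_iff)
        qed
        then show "\<forall>\<^sub>F m in sequentially. indicator (box (- (real m *\<^sub>R One)) (real m *\<^sub>R One)) x *\<^sub>R h x =
            indicator UNIV x *\<^sub>R h x"
          by (intro eventually_sequentiallyI[of n]) (simp add: indicator_def)
      qed
      show "(\<lambda>x. indicator (box (- (real n *\<^sub>R One)) (real n *\<^sub>R One)) x *\<^sub>R h x) \<in> borel_measurable lebesgue" for n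
        using sint[of "box (- (real n *\<^sub>R One)) (real n *\<^sub>R One)"] by (simp add: set_integrable_def)
    qed (use int in \<open>auto simp: indicator_def\<close>)
    then show ?thesis
      using zero LIMSEQ_unique[OF _ tendsto_const] by (simp add: set_lebesgue_integral_def)
  qed
  have borel: "(LINT x:A|lebesgue. h x) = 0" if "A \<in> sets borel" for A
  proof -
    let ?G = "range (\<lambda>(a, b). box a b :: 'a set)"
    have A: "A \<in> sigma_sets UNIV ?G"
      using that unfolding borel_eq_box by simp
    have sub: "B \<in> sets borel" if "B \<in> sigma_sets UNIV ?G" for B
      using that unfolding borel_eq_box by simp
    have "Int_stable ?G"
      by (auto simp: Int_stable_def box_Int_box)
    moreover have "?G \<subseteq> Pow UNIV" by simp
    ultimately show ?thesis using A
    proof (induction rule: sigma_sets_induct_disjoint)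
      case (basic B)
      then show ?case using zero by auto
    next
      case empty
      show ?case by (simp add: set_lebesgue_integral_def)
    next
      case (compl B)
      from sub[OF compl.hyps] have "B \<in> sets lebesgue" by simp
      then have "(LINT x:B \<union> (UNIV - B)|lebesgue. h x)
          = (LINT x:B|lebesgue. h x) + (LINT x:UNIV - B|lebesgue. h x)"
        by (intro set_integral_Un sint) auto
      with UNIV compl.IH show ?case by simp
    next
      case (union F)
      have F: "F i \<in> sets lebesgue" for i
      proof -
        have "F i \<in> sets borel"
          by (rule sub) (use union.hyps(2) in blast)
        then show ?thesis by simp
      qed
      then have "(LINT x:(\<Union>i. F i)|lebesgue. h x) = (\<Sum>i. LINT x:F i|lebesgue. h x)"
        using union.hyps(1) by (intro lebesgue_integral_countable_add sint) (auto simp: disjoint_family_on_def)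
      with union.IH show ?case by simp
    qed
  qed
  fix A :: "'a set" assume "A \<in> sets lebesgue"
  \<comment> \<open>A Lebesgue set is a Borel set up to a subset of a Borel null set, so the Borel
    case suffices.\<close>
  then obtain S N N' where A: "A = S \<union> N" "N \<subseteq> N'" "N' \<in> null_sets lborel" "S \<in> sets lborel"
    by (rule sets_completionE)
  have "AE x in lebesgue. x \<notin> N'"
    using A(3) by (intro AE_not_in null_sets_completionI)
  then have "AE x in lebesgue. indicator A x *\<^sub>R h x = indicator S x *\<^sub>R h x"
    by eventually_elim (use A(1,2) in \<open>auto simp: indicator_def\<close>)
  then have "(LINT x:A|lebesgue. h x) = (LINT x:S|lebesgue. h x)"
    unfolding set_lebesgue_integral_def
  proof (rule integral_cong_AE[rotated 2])
    show "(\<lambda>x. indicator A x *\<^sub>R h x) \<in> borel_measurable lebesgue"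
      "(\<lambda>x. indicator S x *\<^sub>R h x) \<in> borel_measurable lebesgue"
      using sint[of A] sint[of S] \<open>A \<in> sets lebesgue\<close> A(4) by (auto simp: set_integrable_def)
  qed
  with borel A(4) show "(LINT x:A|lebesgue. h x) = 0" by simp
qed

lemma zero_outside_support: "x \<notin> closure {x. \<psi> x \<noteq> 0} \<Longrightarrow> \<psi> x = 0"
  using closure_subset[of "{x. \<psi> x \<noteq> 0}"] by auto

text \<open>Bumps converge boundedly to the indicator of a box, so testing with them shows that
  \<open>h\<close> integrates to 0 over every box whose closed box lies in \<open>U\<close>. The
  Dynkin argument applies to \<open>h\<close> cut off to one such box, and countably many closed
  boxes cover \<open>U\<close>.\<close>

lemma fundamental_lemma_calculus_of_variations:
  fixes h :: "real^'n \<Rightarrow> real"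
  assumes "open U"
    and int: "\<And>K. compact K \<Longrightarrow> K \<subseteq> U \<Longrightarrow> set_integrable lebesgue K h"
    and zero: "\<And>\<psi>. test_fun U \<psi> \<Longrightarrow> (LINT x:U|lebesgue. h x * \<psi> x) = 0"
  shows "AE x in lebesgue. x \<in> U \<longrightarrow> h x = 0"
proof -
  have box0: "(LINT x:box a b|lebesgue. h x) = 0" if ab: "cbox a b \<subseteq> U" for a b
  proof -
    have i: "set_integrable lebesgue (cbox a b) h"
      using ab by (intro int) auto
    have "(\<lambda>k. LINT x|lebesgue. bump k a b x * (indicator (cbox a b) x *\<^sub>R h x))
        \<longlonglongrightarrow> (LINT x|lebesgue. indicator (box a b) x *\<^sub>R h x)"
    proof (rule integral_dominated_convergence[where w="\<lambda>x. norm (indicator (cbox a b) x *\<^sub>R h x)"])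
      have "continuous_on UNIV (bump k a b)" for k
        using test_fun_bump[OF ab, of k] Ck_continuous unfolding test_fun_def smooth_fun_def by blast
      then have "bump k a b \<in> borel_measurable lebesgue" for k
        by (intro measurable_completion) (simp add: borel_measurable_continuous_onI)
      then show "(\<lambda>x. bump k a b x * (indicator (cbox a b) x *\<^sub>R h x)) \<in> borel_measurable lebesgue" for k
        using i by (intro borel_measurable_times) (auto simp: set_integrable_def)
      have "set_integrable lebesgue (box a b) h"
        using i by (rule set_integrable_subset) (auto simp: box_subset_cbox)
      then show "(\<lambda>x. indicator (box a b) x *\<^sub>R h x) \<in> borel_measurable lebesgue"
        by (auto simp: set_integrable_def)
      show "integrable lebesgue (\<lambda>x. norm (indicator (cbox a b) x *\<^sub>R h x))"
        using i by (auto simp: set_integrable_def)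
      show "AE x in lebesgue. (\<lambda>k. bump k a b x * (indicator (cbox a b) x *\<^sub>R h x)) \<longlonglongrightarrow> indicator (box a b) x *\<^sub>R h x"
      proof (rule always_eventually, rule allI)
        fix x
        show "(\<lambda>k. bump k a b x * (indicator (cbox a b) x *\<^sub>R h x)) \<longlonglongrightarrow> indicator (box a b) x *\<^sub>R h x"
        proof (cases "x \<in> box a b")
          case True
          then show ?thesis
            using tendsto_mult_right[OF bump_tendsto[OF True], of "h x"] box_subset_cbox[of a b]
            by (auto simp: indicator_def mult.commute)
        qed (simp add: bump_outside)
      qed
      show "AE x in lebesgue. norm (bump k a b x * (indicator (cbox a b) x *\<^sub>R h x)) \<le> norm (indicator (cbox a b) x *\<^sub>R h x)" for k
        using bump_range[of k a b]
        by (intro always_eventually allI) (auto simp: indicator_def abs_mult intro!: mult_left_le_one_le)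
    qed
    moreover have "(LINT x|lebesgue. bump k a b x * (indicator (cbox a b) x *\<^sub>R h x)) = 0" for k
    proof -
      have "(\<lambda>x. bump k a b x * (indicator (cbox a b) x *\<^sub>R h x)) = (\<lambda>x. indicator U x *\<^sub>R (h x * bump k a b x))"
        using ab bump_outside[of _ a b k] box_subset_cbox[of a b]
        by (intro ext) (auto simp: indicator_def)
      then show ?thesis
        using zero[OF test_fun_bump[OF ab, of k]] by (simp add: set_lebesgue_integral_def)
    qed
    ultimately show ?thesis
      using LIMSEQ_unique[OF _ tendsto_const] by (simp add: set_lebesgue_integral_def)
  qed
  have cbox0: "AE x in lebesgue. x \<in> cbox a b \<longrightarrow> h x = 0" if ab: "cbox a b \<subseteq> U" for a b
  proof -
    have "set_integrable lebesgue (box a b) h"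
      using ab by (intro set_integrable_subset[OF int[of "cbox a b"]]) (auto simp: box_subset_cbox)
    moreover have "(LINT x:box c d|lebesgue. indicator (box a b) x *\<^sub>R h x) = 0" for c d
    proof -
      obtain c' d' where eq: "box c d \<inter> box a b = box c' d'"
        using box_Int_box[of c d a b] by blast
      \<comment> \<open>An empty open box may have a nonempty degenerate \<open>cbox\<close> that
        sticks out of \<open>cbox a b\<close>; the inclusion of closed boxes is therefore derived
        only in the nonempty case.\<close>
      show ?thesis
      proof (cases "box c' d' = {}")
        case True
        have "(\<lambda>x. indicator (box c d) x *\<^sub>R indicator (box a b) x *\<^sub>R h x) = (\<lambda>x. 0)"
          using eq True by (intro ext) (auto simp: indicator_def)
        then show ?thesis by (simp only: set_lebesgue_integral_def) simp
      next
        case False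
        then have "box c' d' \<subseteq> box a b" "cbox c' d' = closure (box c' d')"
          using eq by (auto simp: closure_box)
        then have "cbox c' d' \<subseteq> cbox a b"
          by (metis box_subset_cbox closed_cbox closure_minimal subset_trans)
        then have "(LINT x:box c' d'|lebesgue. h x) = 0"
          using ab by (intro box0) auto
        moreover have "(\<lambda>x. indicator (box c d) x *\<^sub>R indicator (box a b) x *\<^sub>R h x) = (\<lambda>x. indicator (box c' d') x *\<^sub>R h x)"
          using eq by (intro ext) (auto simp: indicator_def set_eq_iff)
        ultimately show ?thesis by (simp only: set_lebesgue_integral_def)
      qed
    qed
    ultimately have "AE x in lebesgue. indicator (box a b) x *\<^sub>R h x = 0"
      by (intro AE_zero_if_box_integrals_zero) (auto simp: set_integrable_def)
    \<comment> \<open>The cover of \<open>U\<close> consists of closed boxes, so the null boundary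
      of the box is added here.\<close>
    moreover have "AE x in lebesgue. x \<notin> cbox a b - box a b"
      by (intro AE_not_in null_sets_completionI null_sets_cbox_Diff_box)
    ultimately show ?thesis
      by eventually_elim (auto simp: indicator_def)
  qed
  obtain \<D> where D: "countable \<D>" "\<D> \<subseteq> Pow U" "\<And>X. X \<in> \<D> \<Longrightarrow> \<exists>a b. X = cbox a b" "\<Union>\<D> = U"
    using open_countable_Union_open_cbox[OF \<open>open U\<close>] by metis
  have "AE x in lebesgue. \<forall>X\<in>\<D>. x \<in> X \<longrightarrow> h x = 0"
    using D cbox0 by (subst AE_ball_countable) (auto, blast)
  then show ?thesis
    by eventually_elim (use D(4) in blast)
qed

section \<open>Integration by parts\<close>


lemma DERIV_along_axis:
  assumes "h differentiable (at (x + s *\<^sub>R axis i 1))"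
  shows "((\<lambda>s. h (x + s *\<^sub>R axis i 1)) has_real_derivative pderiv_i i h (x + s *\<^sub>R axis i 1)) (at s)"
proof -
  let ?D = "frechet_derivative h (at (x + s *\<^sub>R axis i 1))"
  have D: "(h has_derivative ?D) (at (x + s *\<^sub>R axis i 1))"
    using assms by (rule differentiable_has_frechet_derivative)
  have "((\<lambda>s. x + s *\<^sub>R axis i 1) has_derivative (\<lambda>s. s *\<^sub>R axis i 1)) (at s)"
    by (auto intro!: derivative_eq_intros)
  from has_derivative_compose[OF this D]
  have "((\<lambda>s. h (x + s *\<^sub>R axis i 1)) has_derivative (\<lambda>s. ?D (s *\<^sub>R axis i 1))) (at s)" .
  moreover have "?D (r *\<^sub>R axis i 1) = pderiv_i i h (x + s *\<^sub>R axis i 1) * r" for r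
    using linear_scale[OF has_derivative_linear[OF D]] by (simp add: pderiv_i_def)
  ultimately show ?thesis
    by (simp add: has_field_derivative_def)
qed

lemma pderiv_i_zero_outside:
  assumes "closed K" "\<And>x. x \<notin> K \<Longrightarrow> h x = 0" "x \<notin> K"
  shows "pderiv_i i h x = 0"
proof -
  have "(h has_derivative (\<lambda>_. 0)) (at x)"
    by (rule has_derivative_transform_within_open[where f="\<lambda>_. 0" and s="- K"])
       (use assms in auto)
  then show ?thesis by (subst pderiv_i_eq) auto
qed

lemma integrable_continuous_compact_support:
  fixes h :: "'a::euclidean_space \<Rightarrow> real"
  assumes "continuous_on UNIV h" "compact K" "\<And>x. x \<notin> K \<Longrightarrow> h x = 0"
  shows "integrable lborel h"
proof -
  have "integrable lborel (\<lambda>x. indicator K x *\<^sub>R h x)"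
    using assms by (intro borel_integrable_compact) (auto intro: continuous_on_subset)
  also have "(\<lambda>x. indicator K x *\<^sub>R h x) = h"
    using assms(3) by (intro ext) (auto simp: indicator_def)
  finally show ?thesis .
qed

text \<open>The difference quotients in direction \<open>i\<close> have integral \<open>0\<close> by translation invariance.\<close>

lemma integral_pderiv_i_eq_0:
  fixes h :: "real^'n \<Rightarrow> real"
  assumes diff: "\<And>x. h differentiable (at x)"
    and cont: "continuous_on UNIV (pderiv_i i h)"
    and K: "compact K" "\<And>x. x \<notin> K \<Longrightarrow> h x = 0"
  shows "(LINT x|lebesgue. pderiv_i i h x) = 0"
proof -
  let ?e = "axis i 1 :: real^'n"
  define t where "t n = inverse (real (Suc n))" for n
  define q where "q n x = (h (x + t n *\<^sub>R ?e) - h x) / t n" for n x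
  have t: "0 < t n" "t n \<le> 1" for n
    by (auto simp: t_def inverse_le_1_iff)
  have t0: "t \<longlonglongrightarrow> 0"
    unfolding t_def by (rule LIMSEQ_inverse_real_of_nat)
  have h: "continuous_on UNIV h"
    using diff by (meson continuous_at_imp_continuous_on differentiable_imp_continuous_within)
  have h_int: "integrable lborel h"
    using h K by (rule integrable_continuous_compact_support)
  have "bounded K" using K(1) by (rule compact_imp_bounded)
  then obtain R where R: "\<And>x. x \<in> K \<Longrightarrow> norm x \<le> R" by (auto simp: bounded_iff)
  have p0: "pderiv_i i h x = 0" if "x \<notin> K" for x
    by (rule pderiv_i_zero_outside[OF compact_imp_closed[OF K(1)] K(2) that])
  have "bounded (pderiv_i i h ` K)"
    using K(1) cont by (intro compact_imp_bounded compact_continuous_image) (auto intro: continuous_on_subset)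
  then obtain B0 where "\<And>x. x \<in> K \<Longrightarrow> \<bar>pderiv_i i h x\<bar> \<le> B0" by (auto simp: bounded_iff)
  then have B: "\<bar>pderiv_i i h x\<bar> \<le> max B0 0" for x
    using p0[of x] by (cases "x \<in> K") (auto simp: le_max_iff_disj)
  \<comment> \<open>The mean value theorem bounds the quotients by the supremum of the derivative.
    As the steps \<open>t n\<close> are at most 1, beyond radius R + 1 both \<open>x\<close> and its
    translate lie outside \<open>K\<close>.\<close>
  have qB: "\<bar>q n x\<bar> \<le> max B0 0 * indicator (cball 0 (R + 1)) x" for n x
  proof (cases "x \<in> cball 0 (R + 1)")
    case True
    obtain z where "h (x + t n *\<^sub>R ?e) - h (x + 0 *\<^sub>R ?e) = (t n - 0) * pderiv_i i h (x + z *\<^sub>R ?e)"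
      using MVT2[of 0 "t n" "\<lambda>s. h (x + s *\<^sub>R ?e)" "\<lambda>s. pderiv_i i h (x + s *\<^sub>R ?e)"]
        DERIV_along_axis[OF diff] t(1)[of n] by blast
    then have "q n x = pderiv_i i h (x + z *\<^sub>R ?e)"
      using t(1)[of n] by (simp add: q_def)
    with B True show ?thesis by simp
  next
    case False
    then have "norm x > R + 1" by simp
    moreover have "norm x \<le> norm (x + t n *\<^sub>R ?e) + norm (t n *\<^sub>R ?e)"
      using norm_triangle_ineq4[of "x + t n *\<^sub>R ?e" "t n *\<^sub>R ?e"] by simp
    moreover have "norm (t n *\<^sub>R ?e) \<le> 1"
      using t[of n] by simp
    ultimately have "x \<notin> K" "x + t n *\<^sub>R ?e \<notin> K"
      using R[of x] R[of "x + t n *\<^sub>R ?e"] by force+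
    then show ?thesis using K(2) by (simp add: q_def)
  qed
  have q0: "integral\<^sup>L lborel (q n) = 0" for n
  proof -
    have [measurable]: "h \<in> borel_measurable borel"
      using h by (rule borel_measurable_continuous_onI)
    have "integrable (distr lborel borel ((+) (t n *\<^sub>R ?e))) h"
      using h_int by (simp add: lborel_distr_plus)
    then have i: "integrable lborel (\<lambda>x. h (t n *\<^sub>R ?e + x))"
      by (subst (asm) integrable_distr_eq) auto
    have "integral\<^sup>L (distr lborel borel ((+) (t n *\<^sub>R ?e))) h = (LINT x|lborel. h (t n *\<^sub>R ?e + x))"
      by (rule integral_distr) auto
    then have "(LINT x|lborel. h (t n *\<^sub>R ?e + x)) = integral\<^sup>L lborel h"
      by (simp add: lborel_distr_plus)
    then show ?thesis
      using i h_int by (simp add: q_def[abs_def] add.commute)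
  qed
  have [measurable]: "h \<in> borel_measurable borel" "pderiv_i i h \<in> borel_measurable borel"
    using h cont by (auto intro: borel_measurable_continuous_onI)
  have "(\<lambda>n. integral\<^sup>L lborel (q n)) \<longlonglongrightarrow> integral\<^sup>L lborel (pderiv_i i h)"
  proof (rule integral_dominated_convergence[where w="\<lambda>x. max B0 0 * indicator (cball 0 (R + 1)) x"])
    show "pderiv_i i h \<in> borel_measurable lborel" by simp
    show "q n \<in> borel_measurable lborel" for n
      unfolding q_def by measurable
    have "integrable lborel (indicat_real (cball 0 (R + 1) :: (real^'n) set))"
      by (intro integrable_real_indicator emeasure_lborel_cball_finite) auto
    then show "integrable lborel (\<lambda>x. max B0 0 * indicat_real (cball 0 (R + 1) :: (real^'n) set) x)"
      by (rule integrable_mult_right)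
    show "AE x in lborel. norm (q n x) \<le> max B0 0 * indicator (cball 0 (R + 1)) x" for n
      using qB by simp
    show "AE x in lborel. (\<lambda>n. q n x) \<longlonglongrightarrow> pderiv_i i h x"
    proof (rule always_eventually, rule allI)
      fix x
      have "((\<lambda>s. h (x + s *\<^sub>R ?e)) has_real_derivative pderiv_i i h x) (at 0)"
        using DERIV_along_axis[OF diff, where x=x and s=0 and i=i] by simp
      then have "((\<lambda>s. (h (x + s *\<^sub>R ?e) - h x) / s) \<longlongrightarrow> pderiv_i i h x) (at 0)"
        by (simp add: DERIV_def)
      moreover have "filterlim t (at 0) sequentially"
        unfolding filterlim_at using t0 t(1) by (auto intro!: always_eventually simp: less_imp_neq[THEN not_sym])
      ultimately show "(\<lambda>n. q n x) \<longlonglongrightarrow> pderiv_i i h x"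
        unfolding q_def by (rule filterlim_compose)
    qed
  qed
  then have "integral\<^sup>L lborel (pderiv_i i h) = 0"
    using q0 LIMSEQ_unique[OF _ tendsto_const] by simp
  then show ?thesis by (simp add: integral_completion)
qed

lemma pderiv_i_chain:
  assumes "\<phi> differentiable (at x)" "(F has_real_derivative F') (at (\<phi> x))"
  shows "pderiv_i i (\<lambda>x. F (\<phi> x)) x = F' * pderiv_i i \<phi> x"
  by (subst pderiv_i_eq[OF has_derivative_compose[OF
        differentiable_has_frechet_derivative[OF assms(1)]
        assms(2)[unfolded has_field_derivative_def]]])
     (simp add: pderiv_i_def)

text \<open>The product \<open>\<phi> x * \<psi> x\<close> inherits the compact support of
  \<open>\<psi>\<close>, so its partial derivative has integral 0; Leibniz's rule splits it into two
  integrable halves.\<close>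

lemma integration_by_parts:
  fixes \<phi> \<psi> :: "real^'n \<Rightarrow> real"
  assumes \<phi>: "\<And>x. \<phi> differentiable (at x)" "continuous_on UNIV (pderiv_i i \<phi>)"
    and \<psi>: "\<And>x. \<psi> differentiable (at x)" "continuous_on UNIV (pderiv_i i \<psi>)"
    and K: "compact K" "\<And>x. x \<notin> K \<Longrightarrow> \<psi> x = 0"
  shows "(LINT x|lebesgue. \<phi> x * pderiv_i i \<psi> x) = - (LINT x|lebesgue. pderiv_i i \<phi> x * \<psi> x)"
proof -
  have c: "continuous_on UNIV \<phi>" "continuous_on UNIV \<psi>"
    using \<phi>(1) \<psi>(1) by (meson continuous_at_imp_continuous_on differentiable_imp_continuous_within)+
  have z: "pderiv_i i \<psi> x = 0" if "x \<notin> K" for x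
    by (rule pderiv_i_zero_outside[OF compact_imp_closed[OF K(1)] K(2) that])
  have eq: "pderiv_i i (\<lambda>x. \<phi> x * \<psi> x) = (\<lambda>x. \<phi> x * pderiv_i i \<psi> x + pderiv_i i \<phi> x * \<psi> x)"
    using \<phi>(1) \<psi>(1) by (intro ext pderiv_i_mult)
  have "(LINT x|lebesgue. pderiv_i i (\<lambda>x. \<phi> x * \<psi> x) x) = 0"
  proof (rule integral_pderiv_i_eq_0[OF _ _ K(1)])
    show "continuous_on UNIV (pderiv_i i (\<lambda>x. \<phi> x * \<psi> x))"
      unfolding eq using c \<phi>(2) \<psi>(2) by (intro continuous_intros)
  qed (use \<phi>(1) \<psi>(1) K(2) in \<open>auto intro: differentiable_mult\<close>)
  moreover have int: "integrable lborel (\<lambda>x. \<phi> x * pderiv_i i \<psi> x)" "integrable lborel (\<lambda>x. pderiv_i i \<phi> x * \<psi> x)"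
    using c \<phi>(2) \<psi>(2) K(2) z by (auto intro!: integrable_continuous_compact_support[OF _ K(1)] continuous_intros)
  ultimately show ?thesis
    unfolding eq
    by (subst (asm) Bochner_Integration.integral_add)
       (auto simp: integrable_completion borel_measurable_integrable add_eq_0_iff)
qed

section \<open>Square integrable functions\<close>


text \<open>Measurability is a separate clause because it cannot be recovered from the square: a
  function with values 1 and -1 may fail to be measurable although its square is constant.\<close>

definition square_integrable :: "'a measure \<Rightarrow> ('a \<Rightarrow> real) \<Rightarrow> bool" where
  "square_integrable M f \<longleftrightarrow> f \<in> borel_measurable M \<and> integrable M (\<lambda>x. (f x)\<^sup>2)"

lemma square_integrable_measurable: "square_integrable M f \<Longrightarrow> f \<in> borel_measurable M"
  by (simp add: square_integrable_def)

text \<open>Young's inequality with a free weight, up to a factor 2. A suitable choice of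
  \<open>c\<close> later does the work of the Cauchy-Schwarz inequality in L^2.\<close>

lemma abs_mult_le_squares:
  fixes a b :: real
  assumes "c > 0"
  shows "\<bar>a * b\<bar> \<le> c * b\<^sup>2 + a\<^sup>2 / c"
proof -
  have "0 \<le> (\<bar>a\<bar> / c - \<bar>b\<bar>)\<^sup>2 * c"
    using assms by simp
  also have "\<dots> = c * b\<^sup>2 + a\<^sup>2 / c - 2 * \<bar>a * b\<bar>"
    using assms by (simp add: power2_eq_square field_simps abs_mult)
  finally show ?thesis by (smt (verit) abs_ge_zero)
qed

lemma integrable_mult_square:
  assumes "square_integrable M f" "square_integrable M g"
  shows "integrable M (\<lambda>x. f x * g x)"
proof (rule Bochner_Integration.integrable_bound)
  show "integrable M (\<lambda>x. (g x)\<^sup>2 + (f x)\<^sup>2)"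
    using assms by (simp add: square_integrable_def)
  show "AE x in M. norm (f x * g x) \<le> norm ((g x)\<^sup>2 + (f x)\<^sup>2)"
    using abs_mult_le_squares[of 1] by (intro always_eventually allI) simp
qed (use assms in \<open>auto simp: square_integrable_def\<close>)

lemma square_integrable_diff:
  assumes "square_integrable M f" "square_integrable M g"
  shows "square_integrable M (\<lambda>x. f x - g x)"
  unfolding square_integrable_def
proof
  have "integrable M (\<lambda>x. (f x)\<^sup>2 + (g x)\<^sup>2 - 2 * (f x * g x))"
    using assms integrable_mult_square[OF assms] by (simp add: square_integrable_def)
  also have "(\<lambda>x. (f x)\<^sup>2 + (g x)\<^sup>2 - 2 * (f x * g x)) = (\<lambda>x. (f x - g x)\<^sup>2)"
    by (simp add: power2_diff algebra_simps)
  finally show "integrable M (\<lambda>x. (f x - g x)\<^sup>2)" .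
qed (use assms in \<open>auto simp: square_integrable_def\<close>)

lemma square_integrable_mult_bounded:
  assumes "square_integrable M f" "g \<in> borel_measurable M" "AE x in M. \<bar>g x\<bar> \<le> C"
  shows "square_integrable M (\<lambda>x. g x * f x)"
  unfolding square_integrable_def
proof
  show "integrable M (\<lambda>x. (g x * f x)\<^sup>2)"
  proof (rule Bochner_Integration.integrable_bound)
    show "integrable M (\<lambda>x. C\<^sup>2 * (f x)\<^sup>2)"
      using assms by (simp add: square_integrable_def)
    show "AE x in M. norm ((g x * f x)\<^sup>2) \<le> norm (C\<^sup>2 * (f x)\<^sup>2)"
      using assms(3)
    proof eventually_elim
      case (elim x)
      then have "(g x)\<^sup>2 \<le> C\<^sup>2" by (simp add: abs_le_square_iff [symmetric])
      then show ?case by (simp add: power_mult_distrib mult_right_mono)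
    qed
  qed (use assms in \<open>auto simp: square_integrable_def\<close>)
qed (use assms in \<open>auto simp: square_integrable_def\<close>)

lemma (in finite_measure) square_integrable_bounded:
  assumes "g \<in> borel_measurable M" "AE x in M. \<bar>g x\<bar> \<le> C"
  shows "square_integrable M g"
proof -
  have "square_integrable M (\<lambda>x. 1)" by (simp add: square_integrable_def)
  from square_integrable_mult_bounded[OF this assms] show ?thesis by simp
qed

lemma integral_abs_mult_tendsto_0:
  assumes a: "\<And>k. square_integrable M (a k)" and b: "square_integrable M b"
    and lim: "(\<lambda>k. LINT x|M. (a k x)\<^sup>2) \<longlonglongrightarrow> 0"
  shows "(\<lambda>k. LINT x|M. \<bar>a k x * b x\<bar>) \<longlonglongrightarrow> 0"
proof (rule LIMSEQ_I)
  fix e :: real assume "e > 0"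
  define B where "B = (LINT x|M. (b x)\<^sup>2)"
  have "B \<ge> 0" unfolding B_def by simp
  \<comment> \<open>Chosen so that c B < e / 2; adding 1 to \<open>B\<close> covers the case B = 0.
    The other summand of Young's inequality tends to 0 for this fixed \<open>c\<close>.\<close>
  define c where "c = e / (2 * (B + 1))"
  have "c > 0" using \<open>e > 0\<close> \<open>B \<ge> 0\<close> by (simp add: c_def)
  have cB: "c * B < e / 2"
    using \<open>e > 0\<close> \<open>B \<ge> 0\<close> by (simp add: c_def field_simps)
  have bound: "(LINT x|M. \<bar>a k x * b x\<bar>) \<le> c * B + (LINT x|M. (a k x)\<^sup>2) / c" for k
  proof -
    have "(LINT x|M. \<bar>a k x * b x\<bar>) \<le> (LINT x|M. c * (b x)\<^sup>2 + (a k x)\<^sup>2 / c)"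
      using a[of k] b integrable_mult_square[OF a[of k] b] \<open>c > 0\<close>
      by (intro integral_mono abs_mult_le_squares integrable_abs) (auto simp: square_integrable_def)
    also have "\<dots> = c * B + (LINT x|M. (a k x)\<^sup>2) / c"
      using a[of k] b by (simp add: square_integrable_def B_def)
    finally show ?thesis .
  qed
  obtain k0 where k0: "\<And>k. k \<ge> k0 \<Longrightarrow> \<bar>LINT x|M. (a k x)\<^sup>2\<bar> < c * (e / 2)"
    using LIMSEQ_D[OF lim, of "c * (e / 2)"] \<open>c > 0\<close> \<open>e > 0\<close> by auto
  show "\<exists>k0. \<forall>k\<ge>k0. norm ((LINT x|M. \<bar>a k x * b x\<bar>) - 0) < e"
  proof (intro exI allI impI)
    fix k assume "k \<ge> k0"
    then have "(LINT x|M. (a k x)\<^sup>2) / c < e / 2"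
      using k0[of k] \<open>c > 0\<close> by (simp add: pos_divide_less_eq mult.commute)
    then have "(LINT x|M. \<bar>a k x * b x\<bar>) < e"
      using bound[of k] cB by linarith
    then show "norm ((LINT x|M. \<bar>a k x * b x\<bar>) - 0) < e" by simp
  qed
qed

lemma integral_mult_tendsto:
  assumes a: "\<And>k. square_integrable M (a k)" "square_integrable M f" and b: "square_integrable M b"
    and lim: "(\<lambda>k. LINT x|M. (a k x - f x)\<^sup>2) \<longlonglongrightarrow> 0"
  shows "(\<lambda>k. LINT x|M. a k x * b x) \<longlonglongrightarrow> (LINT x|M. f x * b x)"
proof (rule LIM_zero_cancel, rule Lim_null_comparison)
  show "(\<lambda>k. LINT x|M. \<bar>(a k x - f x) * b x\<bar>) \<longlonglongrightarrow> 0"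
    using a b lim by (intro integral_abs_mult_tendsto_0 square_integrable_diff)
  show "\<forall>\<^sub>F k in sequentially. norm ((LINT x|M. a k x * b x) - (LINT x|M. f x * b x))
      \<le> (LINT x|M. \<bar>(a k x - f x) * b x\<bar>)"
  proof (rule always_eventually, rule allI)
    fix k
    have "(LINT x|M. a k x * b x) - (LINT x|M. f x * b x) = (LINT x|M. (a k x - f x) * b x)"
      using a b by (subst Bochner_Integration.integral_diff[symmetric])
        (auto intro: integrable_mult_square simp: algebra_simps)
    then show "norm ((LINT x|M. a k x * b x) - (LINT x|M. f x * b x)) \<le> (LINT x|M. \<bar>(a k x - f x) * b x\<bar>)"
      using integral_norm_bound[of M "\<lambda>x. (a k x - f x) * b x"] by simp
  qed
qed

text \<open>Split at the threshold \<open>d\<close>: below it the square is at most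
  \<open>d\<^sup>2\<close>; above it the ratio |t| / d is at least 1, where the exponent p \<ge> 2
  dominates. A small \<open>d\<close> makes the additive constant small, at the price of a large
  factor in front of the p-th power.\<close>

lemma power2_le_powr:
  fixes p d t :: real
  assumes "p \<ge> 2" "d > 0"
  shows "t\<^sup>2 \<le> d\<^sup>2 + d\<^sup>2 * d powr (- p) * \<bar>t\<bar> powr p"
proof (cases "\<bar>t\<bar> \<le> d")
  case True
  then have "t\<^sup>2 \<le> d\<^sup>2" using power_mono[of "\<bar>t\<bar>" d 2] by simp
  moreover have "0 \<le> d\<^sup>2 * d powr (- p) * \<bar>t\<bar> powr p" by simp
  ultimately show ?thesis by linarith
next
  case False
  then have s: "\<bar>t\<bar> / d \<ge> 1" using assms by simp
  have "(\<bar>t\<bar> / d) powr 2 \<le> (\<bar>t\<bar> / d) powr p"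
    using s assms by (intro powr_mono) auto
  then have "t\<^sup>2 / d\<^sup>2 \<le> \<bar>t\<bar> powr p * d powr (- p)"
    using assms by (simp add: powr_divide powr_minus_divide power_divide)
  then have "t\<^sup>2 \<le> d\<^sup>2 * (\<bar>t\<bar> powr p * d powr (- p))"
    using assms by (simp add: pos_divide_le_eq mult.commute)
  then show ?thesis by (simp add: algebra_simps add_increasing)
qed

lemma (in finite_measure) square_integrable_if_powr:
  fixes p :: real
  assumes "p \<ge> 2" "f \<in> borel_measurable M" "integrable M (\<lambda>x. \<bar>f x\<bar> powr p)"
  shows "square_integrable M f"
  unfolding square_integrable_def
proof
  show "integrable M (\<lambda>x. (f x)\<^sup>2)"
  proof (rule Bochner_Integration.integrable_bound)
    show "integrable M (\<lambda>x. 1 + \<bar>f x\<bar> powr p)" using assms by simp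
    show "AE x in M. norm ((f x)\<^sup>2) \<le> norm (1 + \<bar>f x\<bar> powr p)"
      using power2_le_powr[OF assms(1), of 1] by simp
  qed (use assms(2) in auto)
qed (rule assms(2))

text \<open>A substitute for Hoelder's inequality: integrating \<open>power2_le_powr\<close> costs
  \<open>d\<^sup>2\<close> times the total mass, which is made at most e / 2, plus a fixed multiple
  of the vanishing p-th power integral.\<close>

lemma (in finite_measure) square_integral_tendsto_0_if_powr:
  fixes p :: real and a :: "nat \<Rightarrow> 'a \<Rightarrow> real"
  assumes "p \<ge> 2" and meas: "\<And>k. a k \<in> borel_measurable M" and int: "\<And>k. integrable M (\<lambda>x. \<bar>a k x\<bar> powr p)"
    and lim: "(\<lambda>k. LINT x|M. \<bar>a k x\<bar> powr p) \<longlonglongrightarrow> 0"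
  shows "(\<lambda>k. LINT x|M. (a k x)\<^sup>2) \<longlonglongrightarrow> 0"
proof (rule LIMSEQ_I)
  fix e :: real assume "e > 0"
  define m where "m = measure M (space M) + 1"
  have "m > 0" unfolding m_def using measure_nonneg[of M "space M"] by linarith
  \<comment> \<open>\<open>m\<close> is the total mass plus 1, hence positive even for the null
    measure, and \<open>d\<^sup>2 * m\<close> equals e / 2.\<close>
  define d where "d = sqrt (e / (2 * m))"
  have "d > 0" "d\<^sup>2 = e / (2 * m)" using \<open>e > 0\<close> \<open>m > 0\<close> by (auto simp: d_def)
  define c where "c = d\<^sup>2 * d powr (- p)"
  have "c > 0" using \<open>d > 0\<close> by (simp add: c_def)
  have bound: "(LINT x|M. (a k x)\<^sup>2) \<le> e / 2 + c * (LINT x|M. \<bar>a k x\<bar> powr p)" for k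
  proof -
    have "(LINT x|M. (a k x)\<^sup>2) \<le> (LINT x|M. d\<^sup>2 + c * \<bar>a k x\<bar> powr p)"
      using int[of k] power2_le_powr[OF \<open>p \<ge> 2\<close> \<open>d > 0\<close>] square_integrable_if_powr[OF \<open>p \<ge> 2\<close> meas int]
      by (intro integral_mono) (auto simp: square_integrable_def c_def)
    also have "\<dots> = d\<^sup>2 * measure M (space M) + c * (LINT x|M. \<bar>a k x\<bar> powr p)"
      using int[of k] by simp
    also have "d\<^sup>2 * measure M (space M) \<le> d\<^sup>2 * m"
      by (intro mult_left_mono) (auto simp: m_def)
    also have "d\<^sup>2 * m = e / 2" using \<open>d\<^sup>2 = _\<close> \<open>m > 0\<close> by simp
    finally show ?thesis by simp
  qed
  obtain k0 where k0: "\<And>k. k \<ge> k0 \<Longrightarrow> \<bar>LINT x|M. \<bar>a k x\<bar> powr p\<bar> < e / 2 / c"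
    using LIMSEQ_D[OF lim, of "e / 2 / c"] \<open>c > 0\<close> \<open>e > 0\<close> by auto
  show "\<exists>k0. \<forall>k\<ge>k0. norm ((LINT x|M. (a k x)\<^sup>2) - 0) < e"
  proof (intro exI allI impI)
    fix k assume "k \<ge> k0"
    then have "c * (LINT x|M. \<bar>a k x\<bar> powr p) < e / 2"
      using k0[of k] \<open>c > 0\<close> by (simp add: pos_less_divide_eq mult.commute)
    then have "(LINT x|M. (a k x)\<^sup>2) < e" using bound[of k] by linarith
    then show "norm ((LINT x|M. (a k x)\<^sup>2) - 0) < e" by simp
  qed
qed

section \<open>Approximation in Sobolev spaces\<close>


lemma cgrad_nth [simp]: "cgrad \<phi> x $ i = pderiv_i i \<phi> x"
  by (simp add: cgrad_def)

lemma smooth_fun_differentiable: "smooth_fun \<phi> \<Longrightarrow> \<phi> differentiable (at x)"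
  unfolding smooth_fun_def by (metis Ck.simps(2))

lemma smooth_fun_continuous: "smooth_fun \<phi> \<Longrightarrow> continuous_on UNIV \<phi>"
  unfolding smooth_fun_def by (metis Ck_continuous)

lemma smooth_fun_pderiv_continuous: "smooth_fun \<phi> \<Longrightarrow> continuous_on UNIV (pderiv_i i \<phi>)"
  unfolding smooth_fun_def by (metis Ck.simps(2) Ck_continuous)

lemma test_fun_smooth: "test_fun U \<psi> \<Longrightarrow> smooth_fun \<psi>"
  by (simp add: test_fun_def)

lemma test_fun_mono: "test_fun U \<psi> \<Longrightarrow> U \<subseteq> V \<Longrightarrow> test_fun V \<psi>"
  by (auto simp: test_fun_def)

lemma test_fun_mult:
  assumes "smooth_fun \<phi>" "test_fun U \<psi>"
  shows "test_fun U (\<lambda>x. \<phi> x * \<psi> x)"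
proof -
  have sub: "closure {x. \<phi> x * \<psi> x \<noteq> 0} \<subseteq> closure {x. \<psi> x \<noteq> 0}"
    by (rule closure_mono) auto
  have "compact (closure {x. \<psi> x \<noteq> 0} \<inter> closure {x. \<phi> x * \<psi> x \<noteq> 0})"
    using assms(2) by (intro compact_Int_closed) (auto simp: test_fun_def)
  also have "closure {x. \<psi> x \<noteq> 0} \<inter> closure {x. \<phi> x * \<psi> x \<noteq> 0} = closure {x. \<phi> x * \<psi> x \<noteq> 0}"
    using sub by blast
  finally have "compact (closure {x. \<phi> x * \<psi> x \<noteq> 0})" .
  moreover have "smooth_fun (\<lambda>x. \<phi> x * \<psi> x)"
    using assms by (simp add: test_fun_def smooth_fun_def Ck_mult)
  moreover have "closure {x. \<psi> x \<noteq> 0} \<subseteq> U"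
    using assms(2) by (simp add: test_fun_def)
  ultimately show ?thesis
    using sub by (simp add: test_fun_def)
qed

section \<open>Restriction to compact sets and L^p bounds\<close>

lemma finite_measure_lebesgue_on_compact:
  "compact (K :: 'a::euclidean_space set) \<Longrightarrow> finite_measure (lebesgue_on K)"
  by (intro finite_measure_lebesgue_on lmeasurable_compact)

lemma compact_sets_lebesgue: "compact (K :: 'a::euclidean_space set) \<Longrightarrow> K \<in> sets lebesgue"
  by (intro fmeasurableD lmeasurable_compact)

lemma set_integrable_iff_lebesgue_on:
  fixes h :: "'a::euclidean_space \<Rightarrow> real"
  shows "S \<in> sets lebesgue \<Longrightarrow> set_integrable lebesgue S h \<longleftrightarrow> integrable (lebesgue_on S) h"
  unfolding set_integrable_def by (simp add: integrable_restrict_space)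

lemma set_integral_eq_lebesgue_on:
  fixes h :: "'a::euclidean_space \<Rightarrow> real"
  assumes "K \<in> sets lebesgue" "K \<subseteq> V" "\<And>x. x \<notin> K \<Longrightarrow> h x = 0"
  shows "(LINT x:V|lebesgue. h x) = (LINT x|lebesgue_on K. h x)"
proof -
  have "(\<lambda>x. indicator V x *\<^sub>R h x) = (\<lambda>x. indicator K x *\<^sub>R h x)"
    using assms(2,3) by (intro ext) (auto simp: indicator_def)
  then show ?thesis
    using assms(1) by (simp add: set_lebesgue_integral_def integral_restrict_space)
qed

lemma measurable_lebesgue_on_subset:
  fixes w :: "'a::euclidean_space \<Rightarrow> 'b::real_normed_vector"
  assumes "set_borel_measurable lebesgue V w" "K \<in> sets lebesgue" "K \<subseteq> V"
  shows "w \<in> borel_measurable (lebesgue_on K)"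
proof -
  have "(\<lambda>x. indicator V x *\<^sub>R w x) \<in> borel_measurable (lebesgue_on K)"
    using assms(1) unfolding set_borel_measurable_def by (rule measurable_restrict_space1)
  then show ?thesis
    by (rule measurable_cong[THEN iffD1, rotated]) (use assms(3) in \<open>auto simp: indicator_def\<close>)
qed

lemma continuous_borel_measurable_lebesgue_on:
  fixes c :: "'a::euclidean_space \<Rightarrow> 'b::topological_space"
  assumes "continuous_on UNIV c"
  shows "c \<in> borel_measurable (lebesgue_on K)"
  using assms by (intro measurable_restrict_space1 measurable_completion) (simp add: borel_measurable_continuous_onI)

lemma square_integrable_mult_continuous:
  fixes c :: "'a::euclidean_space \<Rightarrow> real"
  assumes "compact K" "square_integrable (lebesgue_on K) f" "continuous_on UNIV c"
  shows "square_integrable (lebesgue_on K) (\<lambda>x. f x * c x)"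
proof -
  have "bounded (c ` K)"
    using assms by (intro compact_imp_bounded compact_continuous_image) (auto intro: continuous_on_subset)
  then obtain C where "\<And>x. x \<in> K \<Longrightarrow> \<bar>c x\<bar> \<le> C" by (auto simp: bounded_iff)
  then have "AE x in lebesgue_on K. \<bar>c x\<bar> \<le> C" by (intro AE_I2) auto
  from square_integrable_mult_bounded[OF assms(2) _ this] show ?thesis
    by (simp add: continuous_borel_measurable_lebesgue_on[OF assms(3)] mult.commute)
qed

lemma square_integrable_continuous:
  fixes c :: "'a::euclidean_space \<Rightarrow> real"
  assumes "compact K" "continuous_on UNIV c"
  shows "square_integrable (lebesgue_on K) c"
proof -
  interpret finite_measure "lebesgue_on K" by (rule finite_measure_lebesgue_on_compact[OF assms(1)])
  have "square_integrable (lebesgue_on K) (\<lambda>x. 1)" by (simp add: square_integrable_def)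
  from square_integrable_mult_continuous[OF assms(1) this assms(2)] show ?thesis by simp
qed

lemma norm_diff_powr_le:
  fixes a b :: "'a::real_normed_vector"
  assumes "p \<ge> 0"
  shows "norm (a - b) powr p \<le> 2 powr p * (norm a powr p + norm b powr p)"
proof -
  have "norm (a - b) \<le> 2 * max (norm a) (norm b)"
    using norm_triangle_ineq4[of a b] by linarith
  then have "norm (a - b) powr p \<le> (2 * max (norm a) (norm b)) powr p"
    using assms by (intro powr_mono2) auto
  also have "\<dots> = 2 powr p * max (norm a) (norm b) powr p"
    by (simp add: powr_mult)
  also have "\<dots> \<le> 2 powr p * (norm a powr p + norm b powr p)"
    by (intro mult_left_mono) (auto simp: max_def)
  finally show ?thesis .
qed

lemma set_integrable_norm_diff_powr:
  fixes a b :: "'a::euclidean_space \<Rightarrow> 'b::{second_countable_topology,banach}"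
  assumes "p \<ge> 0" "V \<in> sets lebesgue"
    and "set_borel_measurable lebesgue V a" "set_borel_measurable lebesgue V b"
    and "set_integrable lebesgue V (\<lambda>x. norm (a x) powr p)" "set_integrable lebesgue V (\<lambda>x. norm (b x) powr p)"
  shows "set_integrable lebesgue V (\<lambda>x. norm (a x - b x) powr p)"
proof -
  have [measurable]: "a \<in> borel_measurable (lebesgue_on V)" "b \<in> borel_measurable (lebesgue_on V)"
    using assms measurable_lebesgue_on_subset by blast+
  have "integrable (lebesgue_on V) (\<lambda>x. norm (a x - b x) powr p)"
  proof (rule Bochner_Integration.integrable_bound)
    show "integrable (lebesgue_on V) (\<lambda>x. 2 powr p * (norm (a x) powr p + norm (b x) powr p))"
      using assms by (simp add: set_integrable_iff_lebesgue_on)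
    show "AE x in lebesgue_on V. norm (norm (a x - b x) powr p) \<le> norm (2 powr p * (norm (a x) powr p + norm (b x) powr p))"
    proof -
      have "norm (a x - b x) powr p \<le> 2 powr p * (norm (a x) powr p + norm (b x) powr p)" for x
        by (rule norm_diff_powr_le[OF assms(1)])
      then show ?thesis by (intro AE_I2) simp
    qed
  qed measurable
  then show ?thesis using assms(2) by (simp add: set_integrable_iff_lebesgue_on)
qed

lemma set_integrable_norm_powr_continuous_compact_support:
  fixes c :: "'a::euclidean_space \<Rightarrow> 'b::real_normed_vector"
  assumes "p > 0" "V \<in> sets lebesgue" "continuous_on UNIV c" "compact K" "\<And>x. x \<notin> K \<Longrightarrow> c x = 0"
  shows "set_integrable lebesgue V (\<lambda>x. norm (c x) powr p)"
proof -
  have "continuous_on UNIV (\<lambda>x. norm (c x) powr p)"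
    using assms(1,3) by (intro continuous_on_powr' continuous_on_norm continuous_on_const) auto
  then have "integrable lborel (\<lambda>x. norm (c x) powr p)"
    by (rule integrable_continuous_compact_support[OF _ assms(4)]) (simp add: assms(5))
  then have "integrable lebesgue (\<lambda>x. norm (c x) powr p)"
    by (simp add: integrable_completion borel_measurable_integrable)
  then show ?thesis
    using assms(2) unfolding set_integrable_def by (rule integrable_mult_indicator[rotated])
qed

text \<open>Converts membership in \<open>W01p\<close> into the form used from here on: one sequence
  of test functions that converges, together with each partial derivative, in L^2 over a compact
  set. The compact set has finite measure, so p \<ge> 2 makes L^p convergence the stronger
  one.\<close>

lemma W01p_approximation:
  fixes w :: "real^'n \<Rightarrow> real"
  assumes W: "W01p p V w g" and p: "p \<ge> 2" and V: "open V" and K: "compact K" "K \<subseteq> V"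
  obtains \<phi> where "\<And>k. test_fun V (\<phi> k)" "square_integrable (lebesgue_on K) w"
    "\<And>i. square_integrable (lebesgue_on K) (\<lambda>x. g x $ i)"
    "(\<lambda>k. LINT x|lebesgue_on K. (\<phi> k x - w x)\<^sup>2) \<longlonglongrightarrow> 0"
    "\<And>i. (\<lambda>k. LINT x|lebesgue_on K. (pderiv_i i (\<phi> k) x - g x $ i)\<^sup>2) \<longlonglongrightarrow> 0"
proof -
  interpret finite_measure "lebesgue_on K" by (rule finite_measure_lebesgue_on_compact[OF K(1)])
  have Vs: "V \<in> sets lebesgue" and Ks: "K \<in> sets lebesgue"
    using V K(1) by (auto intro: compact_sets_lebesgue)
  from W obtain \<phi> where \<phi>: "\<And>k. test_fun V (\<phi> k)"
    and lim: "(\<lambda>k. LINT x:V|lebesgue. \<bar>\<phi> k x - w x\<bar> powr p + norm (cgrad (\<phi> k) x - g x) powr p) \<longlonglongrightarrow> 0"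
    unfolding W01p_def by blast
  have Lp: "Lp_on p V w" "set_borel_measurable lebesgue V g" "Lp_on p V (\<lambda>x. norm (g x))"
    using W by (auto simp: W01p_def W1p_def)
  then have w: "set_borel_measurable lebesgue V w" "set_integrable lebesgue V (\<lambda>x. \<bar>w x\<bar> powr p)"
    and g: "set_integrable lebesgue V (\<lambda>x. norm (g x) powr p)"
    by (auto simp: Lp_on_def)
  have wK: "w \<in> borel_measurable (lebesgue_on K)" and gK: "g \<in> borel_measurable (lebesgue_on K)"
    using measurable_lebesgue_on_subset w(1) Lp(2) Ks K(2) by blast+
  have giK: "(\<lambda>x. g x $ i) \<in> borel_measurable (lebesgue_on K)" for i
    using gK by (rule measurable_compose) simp
  have contg: "continuous_on UNIV (cgrad (\<phi> k))" for k
    unfolding cgrad_def using smooth_fun_pderiv_continuous[OF test_fun_smooth[OF \<phi>]]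
    by (intro continuous_on_vec_lambda) auto
  have cont: "continuous_on UNIV (\<phi> k)" for k
    using smooth_fun_continuous[OF test_fun_smooth[OF \<phi>]] .
  \<comment> \<open>The limit in \<open>W01p\<close> carries information only for integrable
    integrands, since others have integral 0 by default. Integrability follows from the L^p
    membership of \<open>w\<close> and \<open>g\<close> and the compact support of
    \<open>\<phi> k\<close>.\<close>
  have int1: "set_integrable lebesgue V (\<lambda>x. \<bar>\<phi> k x - w x\<bar> powr p)"
    and int2: "set_integrable lebesgue V (\<lambda>x. norm (cgrad (\<phi> k) x - g x) powr p)" for k
  proof -
    let ?S = "closure {x. \<phi> k x \<noteq> 0}"
    have S: "compact ?S" using \<phi>[of k] by (simp add: test_fun_def)
    have z: "cgrad (\<phi> k) x = 0" if "x \<notin> ?S" for x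
    proof -
      have "pderiv_i i (\<phi> k) x = 0" for i
        by (rule pderiv_i_zero_outside[OF closed_closure _ that]) (rule zero_outside_support)
      then show ?thesis by (simp add: vec_eq_iff)
    qed
    have m: "set_borel_measurable lebesgue V (\<phi> k)" "set_borel_measurable lebesgue V (cgrad (\<phi> k))"
    proof -
      have "\<phi> k \<in> borel_measurable lebesgue" "cgrad (\<phi> k) \<in> borel_measurable lebesgue"
        using cont contg by (auto intro!: measurable_completion borel_measurable_continuous_onI)
      then show "set_borel_measurable lebesgue V (\<phi> k)" "set_borel_measurable lebesgue V (cgrad (\<phi> k))"
        unfolding set_borel_measurable_def
        by (simp_all only: borel_measurable_scaleR[OF borel_measurable_indicator[OF Vs]])
    qed
    have "set_integrable lebesgue V (\<lambda>x. norm (\<phi> k x) powr p)"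
      using p Vs by (intro set_integrable_norm_powr_continuous_compact_support[OF _ _ cont S]) (auto intro: zero_outside_support)
    from set_integrable_norm_diff_powr[OF _ Vs m(1) w(1) this] w(2) p
    show "set_integrable lebesgue V (\<lambda>x. \<bar>\<phi> k x - w x\<bar> powr p)" by simp
    have "set_integrable lebesgue V (\<lambda>x. norm (cgrad (\<phi> k) x) powr p)"
      using p Vs by (intro set_integrable_norm_powr_continuous_compact_support[OF _ _ contg S]) (auto intro: z)
    from set_integrable_norm_diff_powr[OF _ Vs m(2) Lp(2) this] g p
    show "set_integrable lebesgue V (\<lambda>x. norm (cgrad (\<phi> k) x - g x) powr p)" by simp
  qed
  let ?I = "\<lambda>k x. \<bar>\<phi> k x - w x\<bar> powr p + norm (cgrad (\<phi> k) x - g x) powr p"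
  have I: "set_integrable lebesgue V (?I k)" for k
    using int1 int2 by (rule set_integral_add)
  \<comment> \<open>Stated for any sequence whose p-th power is dominated by the integrand of
    \<open>W01p\<close>, so that it covers the function and all components of the gradient at
    once.\<close>
  have L2: "(\<lambda>k. LINT x|lebesgue_on K. (a k x)\<^sup>2) \<longlonglongrightarrow> 0"
    if a: "\<And>k x. \<bar>a k x\<bar> powr p \<le> ?I k x" "\<And>k. a k \<in> borel_measurable (lebesgue_on K)" for a :: "nat \<Rightarrow> real^'n \<Rightarrow> real"
  proof (rule square_integral_tendsto_0_if_powr[OF p a(2)])
    have IK: "integrable (lebesgue_on K) (?I k)" for k
      using set_integrable_subset[OF I Ks K(2)] Ks by (simp add: set_integrable_iff_lebesgue_on)
    show int: "integrable (lebesgue_on K) (\<lambda>x. \<bar>a k x\<bar> powr p)" for k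
    proof (rule Bochner_Integration.integrable_bound[OF IK[of k]])
      show "(\<lambda>x. \<bar>a k x\<bar> powr p) \<in> borel_measurable (lebesgue_on K)"
        using a(2)[of k] by measurable
      show "AE x in lebesgue_on K. norm (\<bar>a k x\<bar> powr p) \<le> norm (?I k x)"
        using a(1) by (intro AE_I2) simp
    qed
    show "(\<lambda>k. LINT x|lebesgue_on K. \<bar>a k x\<bar> powr p) \<longlonglongrightarrow> 0"
    proof (rule tendsto_sandwich[OF _ _ tendsto_const lim])
      show "\<forall>\<^sub>F k in sequentially. 0 \<le> (LINT x|lebesgue_on K. \<bar>a k x\<bar> powr p)"
        by simp
      show "\<forall>\<^sub>F k in sequentially. (LINT x|lebesgue_on K. \<bar>a k x\<bar> powr p) \<le> (LINT x:V|lebesgue. ?I k x)"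
      proof (rule always_eventually, rule allI)
        fix k
        have "(LINT x|lebesgue_on K. \<bar>a k x\<bar> powr p) \<le> (LINT x|lebesgue_on K. ?I k x)"
          using int IK a(1) by (rule integral_mono)
        also have "\<dots> = (LINT x:K|lebesgue. ?I k x)"
          using Ks by (simp add: set_lebesgue_integral_def integral_restrict_space)
        also have "\<dots> \<le> (LINT x:V|lebesgue. ?I k x)"
          unfolding set_lebesgue_integral_def
        proof (rule integral_mono)
          show "integrable lebesgue (\<lambda>x. indicat_real K x *\<^sub>R ?I k x)"
            using set_integrable_subset[OF I Ks K(2)] by (simp add: set_integrable_def)
          show "integrable lebesgue (\<lambda>x. indicat_real V x *\<^sub>R ?I k x)"
            using I by (simp add: set_integrable_def)
          show "indicat_real K x *\<^sub>R ?I k x \<le> indicat_real V x *\<^sub>R ?I k x" for x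
            using K(2) by (auto simp: indicator_def)
        qed
        finally show "(LINT x|lebesgue_on K. \<bar>a k x\<bar> powr p) \<le> (LINT x:V|lebesgue. ?I k x)" .
      qed
    qed
  qed
  show ?thesis
  proof (rule that[of \<phi>])
    show "test_fun V (\<phi> k)" for k by (rule \<phi>)
    have "integrable (lebesgue_on K) (\<lambda>x. \<bar>w x\<bar> powr p)" 
      using set_integrable_subset[OF w(2) Ks K(2)] Ks by (simp add: set_integrable_iff_lebesgue_on)
    then show "square_integrable (lebesgue_on K) w"
      by (rule square_integrable_if_powr[OF p wK])
    show "square_integrable (lebesgue_on K) (\<lambda>x. g x $ i)" for i
    proof (rule square_integrable_if_powr[OF p giK])
      show "integrable (lebesgue_on K) (\<lambda>x. \<bar>g x $ i\<bar> powr p)"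
      proof (rule Bochner_Integration.integrable_bound)
        show "integrable (lebesgue_on K) (\<lambda>x. norm (g x) powr p)"
          using set_integrable_subset[OF g Ks K(2)] Ks by (simp add: set_integrable_iff_lebesgue_on)
        show "(\<lambda>x. \<bar>g x $ i\<bar> powr p) \<in> borel_measurable (lebesgue_on K)"
          using giK by measurable
        show "AE x in lebesgue_on K. norm (\<bar>g x $ i\<bar> powr p) \<le> norm (norm (g x) powr p)"
          using p by (intro AE_I2) (simp add: powr_mono2 component_le_norm_cart)
      qed
    qed
    show "(\<lambda>k. LINT x|lebesgue_on K. (\<phi> k x - w x)\<^sup>2) \<longlonglongrightarrow> 0"
      using wK cont by (intro L2) (auto intro: borel_measurable_diff continuous_borel_measurable_lebesgue_on)
    show "(\<lambda>k. LINT x|lebesgue_on K. (pderiv_i i (\<phi> k) x - g x $ i)\<^sup>2) \<longlonglongrightarrow> 0" for i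
    proof (rule L2)
      show "\<bar>pderiv_i i (\<phi> k) x - g x $ i\<bar> powr p \<le> ?I k x" for k x
      proof -
        have "\<bar>pderiv_i i (\<phi> k) x - g x $ i\<bar> \<le> norm (cgrad (\<phi> k) x - g x)"
          using component_le_norm_cart[of "cgrad (\<phi> k) x - g x" i] by simp
        then have "\<bar>pderiv_i i (\<phi> k) x - g x $ i\<bar> powr p \<le> norm (cgrad (\<phi> k) x - g x) powr p"
          using p by (intro powr_mono2) auto
        then show ?thesis by (simp add: add_increasing)
      qed
      show "(\<lambda>x. pderiv_i i (\<phi> k) x - g x $ i) \<in> borel_measurable (lebesgue_on K)" for k
        by (rule borel_measurable_diff[OF continuous_borel_measurable_lebesgue_on[OF
                smooth_fun_pderiv_continuous[OF test_fun_smooth[OF \<phi>]]] giK])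
    qed
  qed
qed

section \<open>Product and chain rules for weak gradients\<close>


lemma weak_gradD:
  assumes "weak_grad V z dz" "test_fun V \<psi>"
  shows "(LINT x:V|lebesgue. z x * pderiv_i i \<psi> x) = - (LINT x:V|lebesgue. dz x $ i * \<psi> x)"
proof -
  have "(LINT x:V|lebesgue. z x * cgrad \<psi> x $ i) = - (LINT x:V|lebesgue. dz x $ i * \<psi> x)"
    using assms unfolding weak_grad_def by blast
  then show ?thesis by simp
qed

text \<open>\<open>V\<close> may have infinite measure, and functions with a weak gradient are only
  locally integrable. Moving each tested integral to the compact support of the test function gives
  a finite measure on which the L^2 lemmas apply.\<close>

lemma test_fun_set_integral:
  fixes a :: "real^'n \<Rightarrow> real"
  assumes "test_fun V \<psi>"
  shows "(LINT x:V|lebesgue. a x * \<psi> x) = (LINT x|lebesgue_on (closure {x. \<psi> x \<noteq> 0}). a x * \<psi> x)"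
    and "(LINT x:V|lebesgue. a x * pderiv_i i \<psi> x) =
      (LINT x|lebesgue_on (closure {x. \<psi> x \<noteq> 0}). a x * pderiv_i i \<psi> x)"
proof -
  let ?K = "closure {x. \<psi> x \<noteq> 0}"
  have K: "?K \<in> sets lebesgue" "?K \<subseteq> V"
    using assms by (auto simp: test_fun_def)
  have 0: "\<psi> x = 0" if "x \<notin> ?K" for x
    using that by (rule zero_outside_support)
  have d0: "pderiv_i i \<psi> x = 0" if "x \<notin> ?K" for x
    by (rule pderiv_i_zero_outside[OF closed_closure 0 that])
  show "(LINT x:V|lebesgue. a x * \<psi> x) = (LINT x|lebesgue_on ?K. a x * \<psi> x)"
  proof (rule set_integral_eq_lebesgue_on[OF K])
    show "a x * \<psi> x = 0" if "x \<notin> ?K" for x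
      using 0[OF that] by simp
  qed
  show "(LINT x:V|lebesgue. a x * pderiv_i i \<psi> x) = (LINT x|lebesgue_on ?K. a x * pderiv_i i \<psi> x)"
  proof (rule set_integral_eq_lebesgue_on[OF K])
    show "a x * pderiv_i i \<psi> x = 0" if "x \<notin> ?K" for x
      using d0[OF that] by simp
  qed
qed

lemma weak_grad_subset:
  assumes "weak_grad U z dz" "V \<subseteq> U"
  shows "weak_grad V z dz"
  unfolding weak_grad_def
proof (intro conjI allI impI; (elim conjE)?)
  fix \<phi> :: "real^'a \<Rightarrow> real" and i
  assume \<phi>: "test_fun V \<phi>"
  then have "test_fun U \<phi>" using assms(2) by (rule test_fun_mono)
  then show "(LINT x:V|lebesgue. z x * cgrad \<phi> x $ i) = - (LINT x:V|lebesgue. dz x $ i * \<phi> x)"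
    using weak_gradD[OF assms(1), of \<phi> i] by (simp add: test_fun_set_integral \<phi>)
qed (use assms in \<open>auto simp: weak_grad_def\<close>)

lemma weak_grad_diff:
  assumes u: "weak_grad V u du" and v: "weak_grad V v dv"
  shows "weak_grad V (\<lambda>x. u x - v x) (\<lambda>x. du x - dv x)"
  unfolding weak_grad_def
proof (intro conjI allI impI; (elim conjE)?)
  fix \<phi> :: "real^'a \<Rightarrow> real" and i
  assume \<phi>: "test_fun V \<phi>"
  let ?K = "closure {x. \<phi> x \<noteq> 0}"
  have K: "compact ?K" "?K \<subseteq> V" "?K \<in> sets lebesgue"
    using \<phi> by (auto simp: test_fun_def)
  \<comment> \<open>Splitting the integral of a difference requires both parts to be integrable;
    here the factors are an integrable function and a continuous one, which is bounded on the
    compact support.\<close>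
  have int: "integrable (lebesgue_on ?K) (\<lambda>x. a x * c x)"
    if "set_integrable lebesgue ?K a" "continuous_on UNIV c" for a c :: "real^'a \<Rightarrow> real"
  proof -
    have "bounded (c ` ?K)"
      using K that by (intro compact_imp_bounded compact_continuous_image) (auto intro: continuous_on_subset)
    then obtain C where C: "\<And>x. x \<in> ?K \<Longrightarrow> \<bar>c x\<bar> \<le> C" by (auto simp: bounded_iff)
    have a: "integrable (lebesgue_on ?K) a"
      using that(1) K(3) by (simp add: set_integrable_iff_lebesgue_on)
    show ?thesis
    proof (rule Bochner_Integration.integrable_bound)
      show "integrable (lebesgue_on ?K) (\<lambda>x. C * a x)" using a by simp
      show "(\<lambda>x. a x * c x) \<in> borel_measurable (lebesgue_on ?K)"
        using a continuous_borel_measurable_lebesgue_on[OF that(2)] by (intro borel_measurable_times) auto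
      show "AE x in lebesgue_on ?K. norm (a x * c x) \<le> norm (C * a x)"
      proof (rule AE_I2)
        fix x assume "x \<in> space (lebesgue_on ?K)"
        then have "\<bar>c x\<bar> \<le> \<bar>C\<bar>" using C[of x] by simp
        then show "norm (a x * c x) \<le> norm (C * a x)"
          using mult_right_mono[of "\<bar>c x\<bar>" "\<bar>C\<bar>" "\<bar>a x\<bar>"] by (simp add: abs_mult mult.commute)
      qed
    qed
  qed
  have si: "set_integrable lebesgue ?K u" "set_integrable lebesgue ?K v"
    "set_integrable lebesgue ?K (\<lambda>x. du x $ i)" "set_integrable lebesgue ?K (\<lambda>x. dv x $ i)"
    using u v K by (auto simp: weak_grad_def)
  have c: "continuous_on UNIV \<phi>" "continuous_on UNIV (pderiv_i i \<phi>)"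
    using \<phi> by (auto intro: smooth_fun_continuous smooth_fun_pderiv_continuous test_fun_smooth)
  have eq: "(LINT x|lebesgue_on ?K. a x * pderiv_i i \<phi> x) = - (LINT x|lebesgue_on ?K. da x $ i * \<phi> x)"
    if "weak_grad V a da" for a da
    using weak_gradD[OF that \<phi>, of i] by (simp only: test_fun_set_integral[OF \<phi>])
  have "(LINT x|lebesgue_on ?K. (u x - v x) * pderiv_i i \<phi> x) = - (LINT x|lebesgue_on ?K. (du x - dv x) $ i * \<phi> x)"
    using eq[OF u] eq[OF v] int[OF si(1) c(2)] int[OF si(2) c(2)] int[OF si(3) c(1)] int[OF si(4) c(1)]
    by (simp add: left_diff_distrib)
  then show "(LINT x:V|lebesgue. (u x - v x) * cgrad \<phi> x $ i) = - (LINT x:V|lebesgue. (du x - dv x) $ i * \<phi> x)"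
    by (simp only: cgrad_nth test_fun_set_integral[OF \<phi>])
qed (use assms in \<open>auto simp: weak_grad_def intro: set_integral_diff(1)\<close>)

text \<open>The two factors play different roles: \<open>w\<close> contributes smooth approximants
  \<open>\<phi> k\<close>, \<open>z\<close> only its weak gradient. For each \<open>k\<close> the
  product of \<open>\<phi> k\<close> and \<open>\<psi>\<close> is admissible in the weak equation
  for \<open>z\<close>, and Leibniz's rule holds for it classically. Every resulting term pairs one
  L^2 convergent factor with a fixed square integrable one, so the limit exists.\<close>

lemma weak_product_rule:
  fixes w z :: "real^'n \<Rightarrow> real"
  assumes W: "W01p p V w g" and p: "p \<ge> 2" and V: "open V" and z: "weak_grad V z dz"
    and \<psi>: "test_fun V \<psi>"
    and L2: "square_integrable (lebesgue_on (closure {x. \<psi> x \<noteq> 0})) z"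
      "square_integrable (lebesgue_on (closure {x. \<psi> x \<noteq> 0})) (\<lambda>x. dz x $ i)"
  shows "(LINT x:V|lebesgue. w x * z x * pderiv_i i \<psi> x) =
    - (LINT x:V|lebesgue. (g x $ i * z x + w x * dz x $ i) * \<psi> x)"
proof -
  let ?K = "closure {x. \<psi> x \<noteq> 0}"
  let ?M = "lebesgue_on ?K"
  have K: "compact ?K" "?K \<subseteq> V" "?K \<in> sets lebesgue"
    using \<psi> by (auto simp: test_fun_def)
  have \<psi>0: "\<psi> x = 0" if "x \<notin> ?K" for x
    using that by (rule zero_outside_support)
  have d\<psi>0: "pderiv_i i \<psi> x = 0" if "x \<notin> ?K" for x
    by (rule pderiv_i_zero_outside[OF closed_closure \<psi>0 that])
  obtain \<phi> where \<phi>: "\<And>k. test_fun V (\<phi> k)" and w: "square_integrable ?M w"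
    and g: "\<And>i. square_integrable ?M (\<lambda>x. g x $ i)"
    and lim: "(\<lambda>k. LINT x|?M. (\<phi> k x - w x)\<^sup>2) \<longlonglongrightarrow> 0"
      "\<And>i. (\<lambda>k. LINT x|?M. (pderiv_i i (\<phi> k) x - g x $ i)\<^sup>2) \<longlonglongrightarrow> 0"
    by (rule W01p_approximation[OF W p V K(1,2)]) blast
  note \<phi>s = test_fun_smooth[OF \<phi>] and \<psi>s = test_fun_smooth[OF \<psi>]
  have sq\<phi>: "square_integrable ?M (\<phi> k)" "square_integrable ?M (pderiv_i i (\<phi> k))" for k
    by (intro square_integrable_continuous K smooth_fun_continuous smooth_fun_pderiv_continuous \<phi>s)+
  have sq: "square_integrable ?M (\<lambda>x. z x * pderiv_i i \<psi> x)" "square_integrable ?M (\<lambda>x. z x * \<psi> x)"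
     "square_integrable ?M (\<lambda>x. dz x $ i * \<psi> x)"
    by (intro square_integrable_mult_continuous K L2 smooth_fun_continuous smooth_fun_pderiv_continuous \<psi>s)+
  have eq: "(LINT x|?M. \<phi> k x * (z x * pderiv_i i \<psi> x)) + (LINT x|?M. pderiv_i i (\<phi> k) x * (z x * \<psi> x)) =
      - (LINT x|?M. \<phi> k x * (dz x $ i * \<psi> x))" for k
  proof -
    have "test_fun V (\<lambda>x. \<phi> k x * \<psi> x)"
      by (rule test_fun_mult[OF \<phi>s \<psi>])
    from weak_gradD[OF z this, of i]
    have "(LINT x:V|lebesgue. z x * (\<phi> k x * pderiv_i i \<psi> x + pderiv_i i (\<phi> k) x * \<psi> x)) =
        - (LINT x:V|lebesgue. dz x $ i * (\<phi> k x * \<psi> x))"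
      by (simp add: pderiv_i_mult smooth_fun_differentiable \<phi>s \<psi>s)
    moreover have "(LINT x:V|lebesgue. z x * (\<phi> k x * pderiv_i i \<psi> x + pderiv_i i (\<phi> k) x * \<psi> x)) =
        (LINT x|?M. z x * (\<phi> k x * pderiv_i i \<psi> x + pderiv_i i (\<phi> k) x * \<psi> x))"
      using K(3,2)
    proof (rule set_integral_eq_lebesgue_on)
      show "z x * (\<phi> k x * pderiv_i i \<psi> x + pderiv_i i (\<phi> k) x * \<psi> x) = 0" if "x \<notin> ?K" for x
        using \<psi>0[OF that] d\<psi>0[OF that] by simp
    qed
    moreover have "(LINT x:V|lebesgue. dz x $ i * (\<phi> k x * \<psi> x)) = (LINT x|?M. dz x $ i * \<phi> k x * \<psi> x)"
      using test_fun_set_integral(1)[OF \<psi>, of "\<lambda>x. dz x $ i * \<phi> k x"] by (simp add: mult.assoc)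
    moreover have "(LINT x|?M. z x * (\<phi> k x * pderiv_i i \<psi> x + pderiv_i i (\<phi> k) x * \<psi> x)) =
        (LINT x|?M. \<phi> k x * (z x * pderiv_i i \<psi> x) + pderiv_i i (\<phi> k) x * (z x * \<psi> x))"
      by (rule Bochner_Integration.integral_cong) (auto simp: algebra_simps)
    moreover have "\<dots> = (LINT x|?M. \<phi> k x * (z x * pderiv_i i \<psi> x)) + (LINT x|?M. pderiv_i i (\<phi> k) x * (z x * \<psi> x))"
      by (intro Bochner_Integration.integral_add integrable_mult_square sq\<phi> sq)
    moreover have "(LINT x|?M. dz x $ i * \<phi> k x * \<psi> x) = (LINT x|?M. \<phi> k x * (dz x $ i * \<psi> x))"
      by (rule Bochner_Integration.integral_cong) (auto simp: algebra_simps)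
    ultimately show ?thesis by simp
  qed
  have lims: "(\<lambda>k. LINT x|?M. \<phi> k x * (z x * pderiv_i i \<psi> x)) \<longlonglongrightarrow> (LINT x|?M. w x * (z x * pderiv_i i \<psi> x))"
    "(\<lambda>k. LINT x|?M. pderiv_i i (\<phi> k) x * (z x * \<psi> x)) \<longlonglongrightarrow> (LINT x|?M. g x $ i * (z x * \<psi> x))"
    "(\<lambda>k. LINT x|?M. \<phi> k x * (dz x $ i * \<psi> x)) \<longlonglongrightarrow> (LINT x|?M. w x * (dz x $ i * \<psi> x))"
    by (intro integral_mult_tendsto sq\<phi> sq w g lim)+
  have "(LINT x|?M. w x * (z x * pderiv_i i \<psi> x)) + (LINT x|?M. g x $ i * (z x * \<psi> x)) =
      - (LINT x|?M. w x * (dz x $ i * \<psi> x))"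
    using LIMSEQ_unique[OF tendsto_add[OF lims(1,2)]] tendsto_minus[OF lims(3)] eq by simp
  moreover have "(LINT x|?M. g x $ i * (z x * \<psi> x)) + (LINT x|?M. w x * (dz x $ i * \<psi> x)) =
      (LINT x|?M. g x $ i * (z x * \<psi> x) + w x * (dz x $ i * \<psi> x))"
    by (intro Bochner_Integration.integral_add[symmetric] integrable_mult_square w g sq)
  moreover have "(LINT x|?M. g x $ i * (z x * \<psi> x) + w x * (dz x $ i * \<psi> x)) = (LINT x|?M. (g x $ i * z x + w x * dz x $ i) * \<psi> x)"
    by (rule Bochner_Integration.integral_cong) (auto simp: algebra_simps)
  moreover have "(LINT x|?M. w x * (z x * pderiv_i i \<psi> x)) = (LINT x|?M. w x * z x * pderiv_i i \<psi> x)"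
    by (simp add: mult.assoc)
  ultimately have "(LINT x|?M. w x * z x * pderiv_i i \<psi> x) = - (LINT x|?M. (g x $ i * z x + w x * dz x $ i) * \<psi> x)"
    by linarith
  then show ?thesis
    by (simp only: test_fun_set_integral[OF \<psi>])
qed

text \<open>Regularisation by \<open>F c t = arctan (c t) / c\<close>: as \<open>c \<rightarrow> \<infinity>\<close>, \<open>F c\<close> tends to \<open>0\<close> uniformly while its
  derivative tends to the indicator function of \<open>{0}\<close>.\<close>

lemma weak_chain_rule_arctan:
  fixes w :: "real^'n \<Rightarrow> real"
  assumes W: "W01p p V w g" and p: "p \<ge> 2" and V: "open V" and \<psi>: "test_fun V \<psi>" and c: "c > 0"
  shows "(LINT x:V|lebesgue. arctan (c * w x) / c * pderiv_i i \<psi> x) =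
    - (LINT x:V|lebesgue. g x $ i / (1 + (c * w x)\<^sup>2) * \<psi> x)"
proof -
  define F where "F t = arctan (c * t) / c" for t
  define F' where "F' t = 1 / (1 + (c * t)\<^sup>2)" for t
  have pos: "0 < 1 + (c * t)\<^sup>2" for t
    by (smt (verit) zero_le_power2)
  have DF: "(F has_real_derivative F' t) (at t)" for t
  proof -
    have "((\<lambda>t. arctan (c * t)) has_real_derivative inverse (1 + (c * t)\<^sup>2) * c) (at t)"
      by (auto intro!: derivative_eq_intros)
    from DERIV_cdivide[OF this, of c] show ?thesis
      using c by (simp add: F_def[abs_def] F'_def divide_inverse mult.assoc)
  qed
  have F'1: "\<bar>F' t\<bar> \<le> 1" for t
    unfolding F'_def using pos[of t] by simp
  have contF': "continuous_on UNIV F'"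
    unfolding F'_def using pos by (intro continuous_intros) (auto simp: less_imp_neq[THEN not_sym])
  have contF: "continuous_on UNIV F"
    unfolding F_def using c by (intro continuous_intros) auto
  have F1: "\<bar>F s - F t\<bar> \<le> \<bar>s - t\<bar>" for s t
  proof -
    have "norm (F s - F t) \<le> 1 * norm (s - t)"
      by (rule field_differentiable_bound[of UNIV]) (use DF F'1 in auto)
    then show ?thesis by simp
  qed
  \<comment> \<open>A Lipschitz bound on the derivative makes \<open>F' (\<phi> k x)\<close>
    converge in L^2. The constant comes from |F''| = 2 c |c t| / (1 + (c t)^2)^2 and |s| \<le> 1 +
    s^2. It may depend on \<open>c\<close>, because \<open>c\<close> is fixed while k grows.\<close>
  have F'L: "\<bar>F' s - F' t\<bar> \<le> 2 * c * \<bar>s - t\<bar>" for s t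
  proof -
    have D: "(F' has_real_derivative - (2 * c * (c * t)) / (1 + (c * t)\<^sup>2)\<^sup>2) (at t)" for t
      unfolding F'_def using pos[of t]
      by (auto intro!: derivative_eq_intros simp: power2_eq_square)
    have "\<bar>- (2 * c * (c * t)) / (1 + (c * t)\<^sup>2)\<^sup>2\<bar> \<le> 2 * c" for t
    proof -
      have "\<bar>c * t\<bar> \<le> 1 + (c * t)\<^sup>2"
        using abs_mult_le_squares[of 1 1 "c * t"] by simp
      also have "\<dots> \<le> (1 + (c * t)\<^sup>2)\<^sup>2"
        using self_le_power[of "1 + (c * t)\<^sup>2" 2] by simp
      finally have "2 * c * \<bar>c * t\<bar> \<le> 2 * c * (1 + (c * t)\<^sup>2)\<^sup>2"
        using c by (intro mult_left_mono) auto
      then show ?thesis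
        using pos[of t] c by (simp add: abs_mult pos_divide_le_eq)
    qed
    then have "norm (F' s - F' t) \<le> 2 * c * norm (s - t)"
      by (intro field_differentiable_bound[of UNIV]) (use D in auto)
    then show ?thesis by simp
  qed
  let ?K = "closure {x. \<psi> x \<noteq> 0}"
  let ?M = "lebesgue_on ?K"
  have K: "compact ?K" "?K \<subseteq> V" "?K \<in> sets lebesgue"
    using \<psi> by (auto simp: test_fun_def)
  interpret finite_measure ?M by (rule finite_measure_lebesgue_on_compact[OF K(1)])
  have \<psi>0: "\<psi> x = 0" if "x \<notin> ?K" for x
    using that by (rule zero_outside_support)
  have \<psi>': "test_fun UNIV \<psi>"
    using \<psi> by (rule test_fun_mono) simp
  obtain \<phi> where \<phi>: "\<And>k. test_fun V (\<phi> k)" and w: "square_integrable ?M w"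
    and g: "\<And>i. square_integrable ?M (\<lambda>x. g x $ i)"
    and lim: "(\<lambda>k. LINT x|?M. (\<phi> k x - w x)\<^sup>2) \<longlonglongrightarrow> 0"
      "\<And>i. (\<lambda>k. LINT x|?M. (pderiv_i i (\<phi> k) x - g x $ i)\<^sup>2) \<longlonglongrightarrow> 0"
    by (rule W01p_approximation[OF W p V K(1,2)]) blast
  note \<phi>s = test_fun_smooth[OF \<phi>] and \<psi>s = test_fun_smooth[OF \<psi>]
  have sq\<phi>: "square_integrable ?M (\<phi> k)" "square_integrable ?M (pderiv_i i (\<phi> k))" for k
    by (intro square_integrable_continuous K smooth_fun_continuous smooth_fun_pderiv_continuous \<phi>s)+
  have sq\<psi>: "square_integrable ?M \<psi>" "square_integrable ?M (pderiv_i i \<psi>)"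
    by (intro square_integrable_continuous K smooth_fun_continuous smooth_fun_pderiv_continuous \<psi>s)+
  have measF: "(\<lambda>x. F (a x)) \<in> borel_measurable ?M" "(\<lambda>x. F' (a x)) \<in> borel_measurable ?M"
    if "square_integrable ?M a" for a
    using borel_measurable_continuous_onI[OF contF] borel_measurable_continuous_onI[OF contF']
      square_integrable_measurable[OF that] by (auto intro: measurable_compose)
  have sqF': "square_integrable ?M (\<lambda>x. F' (a x) * b x)" "square_integrable ?M (\<lambda>x. F' (a x))"
    if "square_integrable ?M a" "square_integrable ?M b" for a b
  proof -
    have "AE x in ?M. \<bar>F' (a x)\<bar> \<le> 1" using F'1 by simp
    then show "square_integrable ?M (\<lambda>x. F' (a x) * b x)" "square_integrable ?M (\<lambda>x. F' (a x))"
      using square_integrable_mult_bounded[OF that(2) measF(2)[OF that(1)]]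
        square_integrable_bounded[OF measF(2)[OF that(1)]] by blast+
  qed
  have F_bound: "\<bar>F t\<bar> \<le> pi / 2 / c" for t
    unfolding F_def using c arctan_bounded[of "c * t"] by (simp add: field_simps abs_if)
  have sqF: "square_integrable ?M (\<lambda>x. F (a x))" if "square_integrable ?M a" for a
    using F_bound measF[OF that] by (auto intro!: square_integrable_bounded)
  have lip: "(\<lambda>k. LINT x|?M. (G (\<phi> k x) - G (w x))\<^sup>2) \<longlonglongrightarrow> 0"
    if G: "\<And>s t. \<bar>G s - G t\<bar> \<le> L * \<bar>s - t\<bar>" "\<And>a. square_integrable ?M a \<Longrightarrow> square_integrable ?M (\<lambda>x. G (a x))"
    for G :: "real \<Rightarrow> real" and L
  proof (rule tendsto_sandwich[OF _ _ tendsto_const])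
    show "\<forall>\<^sub>F k in sequentially. (LINT x|?M. (G (\<phi> k x) - G (w x))\<^sup>2) \<le> L\<^sup>2 * (LINT x|?M. (\<phi> k x - w x)\<^sup>2)"
    proof (rule always_eventually, rule allI)
      fix k
      have "(LINT x|?M. (G (\<phi> k x) - G (w x))\<^sup>2) \<le> (LINT x|?M. L\<^sup>2 * (\<phi> k x - w x)\<^sup>2)"
      proof (rule integral_mono)
        show "integrable ?M (\<lambda>x. (G (\<phi> k x) - G (w x))\<^sup>2)" "integrable ?M (\<lambda>x. L\<^sup>2 * (\<phi> k x - w x)\<^sup>2)"
          using square_integrable_diff[OF G(2) G(2), OF sq\<phi>(1) w] square_integrable_diff[OF sq\<phi>(1) w]
          by (auto simp: square_integrable_def)
        show "(G (\<phi> k x) - G (w x))\<^sup>2 \<le> L\<^sup>2 * (\<phi> k x - w x)\<^sup>2" for x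
          using power_mono[OF G(1)[of "\<phi> k x" "w x"], of 2] by (simp add: power_mult_distrib)
      qed
      then show "(LINT x|?M. (G (\<phi> k x) - G (w x))\<^sup>2) \<le> L\<^sup>2 * (LINT x|?M. (\<phi> k x - w x)\<^sup>2)" by simp
    qed
    show "(\<lambda>k. L\<^sup>2 * (LINT x|?M. (\<phi> k x - w x)\<^sup>2)) \<longlonglongrightarrow> 0"
      using tendsto_mult_right_zero[OF lim(1)] by simp
  qed simp
  have eq: "(LINT x|?M. F (\<phi> k x) * pderiv_i i \<psi> x) = - (LINT x|?M. pderiv_i i (\<phi> k) x * (F' (\<phi> k x) * \<psi> x))" for k
  proof -
    have chain: "pderiv_i i (\<lambda>x. F (\<phi> k x)) = (\<lambda>x. F' (\<phi> k x) * pderiv_i i (\<phi> k) x)"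
      by (intro ext pderiv_i_chain smooth_fun_differentiable[OF \<phi>s] DF)
    have "(LINT x|lebesgue. F (\<phi> k x) * pderiv_i i \<psi> x) = - (LINT x|lebesgue. pderiv_i i (\<lambda>x. F (\<phi> k x)) x * \<psi> x)"
    proof (rule integration_by_parts[OF _ _ _ _ K(1) \<psi>0])
      show "(\<lambda>x. F (\<phi> k x)) differentiable at x" for x
        using has_derivative_compose[OF differentiable_has_frechet_derivative[OF smooth_fun_differentiable[OF \<phi>s]]
          DF[unfolded has_field_derivative_def]] by (rule differentiableI)
      show "continuous_on UNIV (pderiv_i i (\<lambda>x. F (\<phi> k x)))"
        unfolding chain
        by (intro continuous_intros smooth_fun_pderiv_continuous \<phi>s continuous_on_compose2[OF contF']
            smooth_fun_continuous) auto
    qed (auto intro: smooth_fun_differentiable smooth_fun_pderiv_continuous \<psi>s)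
    then have "(LINT x|?M. F (\<phi> k x) * pderiv_i i \<psi> x) = - (LINT x|?M. F' (\<phi> k x) * pderiv_i i (\<phi> k) x * \<psi> x)"
      unfolding chain
      using test_fun_set_integral[OF \<psi>', of "\<lambda>x. F (\<phi> k x)"]
        test_fun_set_integral(1)[OF \<psi>', of "\<lambda>x. F' (\<phi> k x) * pderiv_i i (\<phi> k) x"]
      by (simp add: set_lebesgue_integral_def)
    then show ?thesis by (simp add: algebra_simps)
  qed
  have lim1: "(\<lambda>k. LINT x|?M. F (\<phi> k x) * pderiv_i i \<psi> x) \<longlonglongrightarrow> (LINT x|?M. F (w x) * pderiv_i i \<psi> x)"
    using lip[of F 1] F1 sqF by (intro integral_mult_tendsto sqF sq\<phi> w sq\<psi>) auto
  \<comment> \<open>In the right-hand side of \<open>eq\<close> two factors vary with k. Replacing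
    the derivative of \<open>\<phi> k\<close> by its limit \<open>g\<close> leaves one varying
    factor, treated here; the error is treated next, where |F'| \<le> 1 removes the other varying
    factor.\<close>
  have lim2: "(\<lambda>k. LINT x|?M. F' (\<phi> k x) * (g x $ i * \<psi> x)) \<longlonglongrightarrow> (LINT x|?M. F' (w x) * (g x $ i * \<psi> x))"
    using lip[of F' "2 * c"] F'L sqF'(2)[OF _ sq\<psi>(1)]
    by (intro integral_mult_tendsto sqF'(2)[OF _ sq\<psi>(1)] sq\<phi> w square_integrable_mult_continuous K g smooth_fun_continuous \<psi>s) auto
  have lim3: "(\<lambda>k. LINT x|?M. (pderiv_i i (\<phi> k) x - g x $ i) * (F' (\<phi> k x) * \<psi> x)) \<longlonglongrightarrow> 0"
  proof (rule Lim_null_comparison)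
    show "(\<lambda>k. LINT x|?M. \<bar>(pderiv_i i (\<phi> k) x - g x $ i) * \<psi> x\<bar>) \<longlonglongrightarrow> 0"
      by (intro integral_abs_mult_tendsto_0 square_integrable_diff sq\<phi> g sq\<psi> lim)
    show "\<forall>\<^sub>F k in sequentially. norm (LINT x|?M. (pderiv_i i (\<phi> k) x - g x $ i) * (F' (\<phi> k x) * \<psi> x))
        \<le> (LINT x|?M. \<bar>(pderiv_i i (\<phi> k) x - g x $ i) * \<psi> x\<bar>)"
    proof (rule always_eventually, rule allI)
      fix k
      have "norm (LINT x|?M. (pderiv_i i (\<phi> k) x - g x $ i) * (F' (\<phi> k x) * \<psi> x))
          \<le> (LINT x|?M. norm ((pderiv_i i (\<phi> k) x - g x $ i) * (F' (\<phi> k x) * \<psi> x)))"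
        by (rule integral_norm_bound)
      also have "\<dots> \<le> (LINT x|?M. \<bar>(pderiv_i i (\<phi> k) x - g x $ i) * \<psi> x\<bar>)"
      proof (rule integral_mono)
        show "integrable ?M (\<lambda>x. norm ((pderiv_i i (\<phi> k) x - g x $ i) * (F' (\<phi> k x) * \<psi> x)))"
          "integrable ?M (\<lambda>x. \<bar>(pderiv_i i (\<phi> k) x - g x $ i) * \<psi> x\<bar>)"
          by (intro integrable_norm integrable_abs integrable_mult_square square_integrable_diff sq\<phi> g sqF' sq\<psi>)+
        show "norm ((pderiv_i i (\<phi> k) x - g x $ i) * (F' (\<phi> k x) * \<psi> x)) \<le> \<bar>(pderiv_i i (\<phi> k) x - g x $ i) * \<psi> x\<bar>" for x
          using F'1[of "\<phi> k x"] by (simp add: abs_mult mult_left_mono mult_left_le_one_le)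
      qed
      finally show "norm (LINT x|?M. (pderiv_i i (\<phi> k) x - g x $ i) * (F' (\<phi> k x) * \<psi> x))
        \<le> (LINT x|?M. \<bar>(pderiv_i i (\<phi> k) x - g x $ i) * \<psi> x\<bar>)" .
    qed
  qed
  have split: "(LINT x|?M. pderiv_i i (\<phi> k) x * (F' (\<phi> k x) * \<psi> x)) =
      (LINT x|?M. F' (\<phi> k x) * (g x $ i * \<psi> x)) + (LINT x|?M. (pderiv_i i (\<phi> k) x - g x $ i) * (F' (\<phi> k x) * \<psi> x))" for k
  proof -
    have "integrable ?M (\<lambda>x. F' (\<phi> k x) * (g x $ i * \<psi> x))"
      by (intro integrable_mult_square sqF'(2)[OF _ sq\<psi>(1)] sq\<phi> square_integrable_mult_continuous K g smooth_fun_continuous \<psi>s)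
    moreover have "integrable ?M (\<lambda>x. (pderiv_i i (\<phi> k) x - g x $ i) * (F' (\<phi> k x) * \<psi> x))"
      by (intro integrable_mult_square square_integrable_diff sq\<phi> g sqF' sq\<psi>)
    ultimately have "(LINT x|?M. F' (\<phi> k x) * (g x $ i * \<psi> x)) + (LINT x|?M. (pderiv_i i (\<phi> k) x - g x $ i) * (F' (\<phi> k x) * \<psi> x))
       = (LINT x|?M. F' (\<phi> k x) * (g x $ i * \<psi> x) + (pderiv_i i (\<phi> k) x - g x $ i) * (F' (\<phi> k x) * \<psi> x))"
      by (rule Bochner_Integration.integral_add[symmetric])
    also have "\<dots> = (LINT x|?M. pderiv_i i (\<phi> k) x * (F' (\<phi> k x) * \<psi> x))"
      by (rule Bochner_Integration.integral_cong) (auto simp: algebra_simps)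
    finally show ?thesis by simp
  qed
  have "(\<lambda>k. - (LINT x|?M. pderiv_i i (\<phi> k) x * (F' (\<phi> k x) * \<psi> x))) \<longlonglongrightarrow> - (LINT x|?M. F' (w x) * (g x $ i * \<psi> x))"
    unfolding split using tendsto_minus[OF tendsto_add[OF lim2 lim3]] by simp
  with lim1 have "(LINT x|?M. F (w x) * pderiv_i i \<psi> x) = - (LINT x|?M. F' (w x) * (g x $ i * \<psi> x))"
    unfolding eq by (rule LIMSEQ_unique)
  also have "(LINT x|?M. F' (w x) * (g x $ i * \<psi> x)) = (LINT x|?M. g x $ i / (1 + (c * w x)\<^sup>2) * \<psi> x)"
    by (simp add: F'_def)
  finally have "(LINT x|?M. arctan (c * w x) / c * pderiv_i i \<psi> x) = - (LINT x|?M. g x $ i / (1 + (c * w x)\<^sup>2) * \<psi> x)"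
    unfolding F_def .
  then show ?thesis
    by (simp only: test_fun_set_integral[OF \<psi>])
qed

section \<open>The gradient of the positive part\<close>


text \<open>On \<open>{z \<noteq> 0}\<close> the gradient is found by comparing the product rules for \<open>w z = w\<^sup>2\<close>, where \<open>w\<close> is the
  positive part of \<open>z\<close>; on \<open>{w = 0}\<close> by letting \<open>c \<rightarrow> \<infinity>\<close> in the previous lemma.\<close>

lemma weak_gradient_positive_part:
  fixes z :: "real^'n \<Rightarrow> real"
  assumes W: "W01p p V (\<lambda>x. max (z x) 0) g" and p: "p \<ge> 2" and V: "open V" and z: "weak_grad V z dz"
    and L2: "\<And>K. compact K \<Longrightarrow> K \<subseteq> V \<Longrightarrow> square_integrable (lebesgue_on K) z"
      "\<And>K i. compact K \<Longrightarrow> K \<subseteq> V \<Longrightarrow> square_integrable (lebesgue_on K) (\<lambda>x. dz x $ i)"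
  shows "AE x in lebesgue. x \<in> V \<longrightarrow> g x = (if z x > 0 then dz x else 0)"
proof -
  define w where "w x = max (z x) 0" for x
  have W: "W01p p V w g" using W by (simp add: w_def[abs_def])
  have wg: "weak_grad V w g" using W by (simp add: W01p_def W1p_def)
  have L2w: "square_integrable (lebesgue_on K) w" "square_integrable (lebesgue_on K) (\<lambda>x. g x $ i)"
    if "compact K" "K \<subseteq> V" for K i
    using W01p_approximation[OF W p V that] by blast+
  \<comment> \<open>Where z > 0, w = z and the identity reduces to w (dz - g) = 0, so that
    \<open>w\<close> cancels. At z = 0 every term vanishes and nothing is learned, whence the second
    claim below.\<close>
  have AE1: "AE x in lebesgue. x \<in> V \<longrightarrow> (g x $ i * z x + w x * dz x $ i) - (g x $ i * w x + w x * g x $ i) = 0" for i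
  proof (rule fundamental_lemma_calculus_of_variations[OF V])
    have int: "integrable (lebesgue_on K) (\<lambda>x. g x $ i * z x + w x * dz x $ i)"
      "integrable (lebesgue_on K) (\<lambda>x. g x $ i * w x + w x * g x $ i)" if K: "compact K" "K \<subseteq> V" for K
      by (intro Bochner_Integration.integrable_add integrable_mult_square L2 L2w K)+
    show "set_integrable lebesgue K (\<lambda>x. (g x $ i * z x + w x * dz x $ i) - (g x $ i * w x + w x * g x $ i))"
      if K: "compact K" "K \<subseteq> V" for K
      using int[OF K] compact_sets_lebesgue[OF K(1)] by (simp add: set_integrable_iff_lebesgue_on)
    fix \<psi> assume \<psi>: "test_fun V \<psi>"
    let ?K = "closure {x. \<psi> x \<noteq> 0}"
    let ?M = "lebesgue_on ?K"
    have K: "compact ?K" "?K \<subseteq> V" using \<psi> by (auto simp: test_fun_def)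
    have c\<psi>: "continuous_on UNIV \<psi>"
      by (rule smooth_fun_continuous[OF test_fun_smooth[OF \<psi>]])
    have int\<psi>: "integrable ?M (\<lambda>x. (g x $ i * z x + w x * dz x $ i) * \<psi> x)"
      "integrable ?M (\<lambda>x. (g x $ i * w x + w x * g x $ i) * \<psi> x)"
    proof -
      have "integrable ?M (\<lambda>x. g x $ i * (z x * \<psi> x) + w x * (dz x $ i * \<psi> x))"
        "integrable ?M (\<lambda>x. g x $ i * (w x * \<psi> x) + w x * (g x $ i * \<psi> x))"
        by (intro Bochner_Integration.integrable_add integrable_mult_square square_integrable_mult_continuous L2 L2w K c\<psi>)+
      then show "integrable ?M (\<lambda>x. (g x $ i * z x + w x * dz x $ i) * \<psi> x)"
        "integrable ?M (\<lambda>x. (g x $ i * w x + w x * g x $ i) * \<psi> x)"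
        by (simp_all add: algebra_simps)
    qed
    have "(\<lambda>x. w x * z x * pderiv_i i \<psi> x) = (\<lambda>x. w x * w x * pderiv_i i \<psi> x)"
      by (auto simp: w_def max_def)
    then have "(LINT x:V|lebesgue. (g x $ i * z x + w x * dz x $ i) * \<psi> x) = (LINT x:V|lebesgue. (g x $ i * w x + w x * g x $ i) * \<psi> x)"
      using weak_product_rule[OF W p V z \<psi> L2[OF K], of i] weak_product_rule[OF W p V wg \<psi> L2w[OF K], of i]
      by (simp only: neg_equal_iff_equal)
    then have "(LINT x|?M. (g x $ i * z x + w x * dz x $ i) * \<psi> x) = (LINT x|?M. (g x $ i * w x + w x * g x $ i) * \<psi> x)"
      by (simp only: test_fun_set_integral[OF \<psi>])
    then have "(LINT x|?M. (g x $ i * z x + w x * dz x $ i) * \<psi> x - (g x $ i * w x + w x * g x $ i) * \<psi> x) = 0"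
      using int\<psi> by simp
    then show "(LINT x:V|lebesgue. ((g x $ i * z x + w x * dz x $ i) - (g x $ i * w x + w x * g x $ i)) * \<psi> x) = 0"
      by (simp only: test_fun_set_integral(1)[OF \<psi>]) (simp only: left_diff_distrib)
  qed
  have AE2: "AE x in lebesgue. x \<in> V \<longrightarrow> (if w x = 0 then g x $ i else 0) = 0" for i
  proof (rule fundamental_lemma_calculus_of_variations[OF V])
    fix K :: "(real^'n) set" assume K: "compact K" "K \<subseteq> V"
    interpret finite_measure "lebesgue_on K" by (rule finite_measure_lebesgue_on_compact[OF K(1)])
    have [measurable]: "w \<in> borel_measurable (lebesgue_on K)" "(\<lambda>x. g x $ i) \<in> borel_measurable (lebesgue_on K)"
      using L2w[OF K] by (auto dest: square_integrable_measurable)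
    have "square_integrable (lebesgue_on K) (\<lambda>x. 1)" by (simp add: square_integrable_def)
    from integrable_mult_square[OF this L2w(2)[OF K]]
    have "integrable (lebesgue_on K) (\<lambda>x. g x $ i)" by simp
    then have "integrable (lebesgue_on K) (\<lambda>x. if w x = 0 then g x $ i else 0)"
      by (rule Bochner_Integration.integrable_bound) auto
    then show "set_integrable lebesgue K (\<lambda>x. if w x = 0 then g x $ i else 0)"
      using compact_sets_lebesgue[OF K(1)] by (simp add: set_integrable_iff_lebesgue_on)
  next
    fix \<psi> assume \<psi>: "test_fun V \<psi>"
    let ?K = "closure {x. \<psi> x \<noteq> 0}"
    let ?M = "lebesgue_on ?K"
    have K: "compact ?K" "?K \<subseteq> V" using \<psi> by (auto simp: test_fun_def)
    have c\<psi>: "continuous_on UNIV \<psi>" "continuous_on UNIV (pderiv_i i \<psi>)"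
      using smooth_fun_continuous smooth_fun_pderiv_continuous test_fun_smooth[OF \<psi>] by blast+
    interpret finite_measure ?M by (rule finite_measure_lebesgue_on_compact[OF K(1)])
    have sq1: "square_integrable ?M (\<lambda>x. 1)" by (simp add: square_integrable_def)
    have [measurable]: "w \<in> borel_measurable ?M" "(\<lambda>x. g x $ i) \<in> borel_measurable ?M"
      "\<psi> \<in> borel_measurable ?M" "pderiv_i i \<psi> \<in> borel_measurable ?M"
      using L2w[OF K] c\<psi> by (auto dest: square_integrable_measurable intro: continuous_borel_measurable_lebesgue_on)
    have int: "integrable ?M (\<lambda>x. g x $ i * \<psi> x)" "integrable ?M (pderiv_i i \<psi>)"
      using integrable_mult_square[OF L2w(2)[OF K] square_integrable_continuous[OF K(1) c\<psi>(1)]]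
        integrable_mult_square[OF sq1 square_integrable_continuous[OF K(1) c\<psi>(2)]] by auto
    \<comment> \<open>Both sides of the chain rule are passed to the limit by dominated convergence:
      arctan is bounded by pi/2, so \<open>?A\<close> vanishes in the limit, while the quotient in
      \<open>?B\<close> keeps \<open>g\<close> on w = 0 and tends to 0 elsewhere. The index
      \<open>Suc n\<close> keeps the parameter positive.\<close>
    let ?A = "\<lambda>n x. arctan (real (Suc n) * w x) / real (Suc n) * pderiv_i i \<psi> x"
    let ?B = "\<lambda>n x. g x $ i / (1 + (real (Suc n) * w x)\<^sup>2) * \<psi> x"
    have AB: "(LINT x|?M. ?A n x) = - (LINT x|?M. ?B n x)" for n
      using weak_chain_rule_arctan[OF W p V \<psi>, of "real (Suc n)" i]
      by (simp only: test_fun_set_integral[OF \<psi>])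
    have A: "(\<lambda>n. LINT x|?M. ?A n x) \<longlonglongrightarrow> (LINT x|?M. 0)"
    proof (rule integral_dominated_convergence[where w="\<lambda>x. pi / 2 * \<bar>pderiv_i i \<psi> x\<bar>"])
      have bd: "\<bar>arctan t / real (Suc n)\<bar> \<le> (pi / 2) * inverse (real (Suc n))" for t n
      proof -
        have "\<bar>arctan t\<bar> \<le> pi / 2" using arctan_bounded[of t] by linarith
        then have "\<bar>arctan t\<bar> * inverse (real (Suc n)) \<le> (pi / 2) * inverse (real (Suc n))"
          by (rule mult_right_mono) simp
        then show ?thesis by (simp only: divide_inverse abs_mult abs_inverse abs_of_nat)
      qed
      show "AE x in ?M. norm (?A n x) \<le> pi / 2 * \<bar>pderiv_i i \<psi> x\<bar>" for n
      proof (rule AE_I2)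
        fix x
        have "pi / 2 * inverse (real (Suc n)) \<le> pi / 2 * 1"
          by (intro mult_left_mono) (auto simp: inverse_le_1_iff)
        then have "\<bar>arctan (real (Suc n) * w x) / real (Suc n)\<bar> \<le> pi / 2"
          using bd[of "real (Suc n) * w x" n] by linarith
        from mult_right_mono[OF this, of "\<bar>pderiv_i i \<psi> x\<bar>"]
        show "norm (?A n x) \<le> pi / 2 * \<bar>pderiv_i i \<psi> x\<bar>" by (simp only: real_norm_def abs_mult abs_ge_zero)
      qed
      show "AE x in ?M. (\<lambda>n. ?A n x) \<longlonglongrightarrow> 0"
      proof (rule AE_I2, rule tendsto_mult_left_zero, rule Lim_null_comparison)
        fix x
        show "\<forall>\<^sub>F n in sequentially. norm (arctan (real (Suc n) * w x) / real (Suc n)) \<le> (pi / 2) * inverse (real (Suc n))"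
          using bd by simp
        show "(\<lambda>n. (pi / 2) * inverse (real (Suc n))) \<longlonglongrightarrow> 0"
          by (rule tendsto_mult_right_zero[OF LIMSEQ_inverse_real_of_nat])
      qed
      show "integrable ?M (\<lambda>x. pi / 2 * \<bar>pderiv_i i \<psi> x\<bar>)"
        using int(2) by simp
      show "?A n \<in> borel_measurable ?M" for n by measurable
    qed simp
    have B: "(\<lambda>n. LINT x|?M. ?B n x) \<longlonglongrightarrow> (LINT x|?M. (if w x = 0 then g x $ i else 0) * \<psi> x)"
    proof (rule integral_dominated_convergence[where w="\<lambda>x. \<bar>g x $ i * \<psi> x\<bar>"])
      show "AE x in ?M. (\<lambda>n. ?B n x) \<longlonglongrightarrow> (if w x = 0 then g x $ i else 0) * \<psi> x"
      proof (rule AE_I2)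
        fix x
        show "(\<lambda>n. ?B n x) \<longlonglongrightarrow> (if w x = 0 then g x $ i else 0) * \<psi> x"
        proof (cases "w x = 0")
          case False
          then have "w x > 0" by (simp add: w_def)
          have "filterlim (\<lambda>n. real (Suc n)) at_top sequentially"
            by (rule filterlim_compose[OF filterlim_real_sequentially filterlim_Suc])
          then have "filterlim (\<lambda>n. w x * real (Suc n)) at_top sequentially"
            by (rule filterlim_tendsto_pos_mult_at_top[OF tendsto_const \<open>w x > 0\<close>])
          then have "filterlim (\<lambda>n. 1 + (w x * real (Suc n))\<^sup>2) at_top sequentially"
            by (intro filterlim_tendsto_add_at_top[OF tendsto_const] filterlim_pow_at_top) simp_all
          then have "(\<lambda>n. g x $ i / (1 + (w x * real (Suc n))\<^sup>2)) \<longlonglongrightarrow> 0"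
            by (intro tendsto_divide_0[OF tendsto_const] filterlim_at_top_imp_at_infinity)
          from tendsto_mult_left_zero[OF this, of "\<psi> x"] False show ?thesis
            by (simp add: mult.commute)
        qed simp
      qed
      show "AE x in ?M. norm (?B n x) \<le> \<bar>g x $ i * \<psi> x\<bar>" for n
      proof (rule AE_I2)
        fix x
        have "1 \<le> 1 + (real (Suc n) * w x)\<^sup>2" by simp
        then have "\<bar>g x $ i\<bar> / (1 + (real (Suc n) * w x)\<^sup>2) \<le> \<bar>g x $ i\<bar>"
          by (smt (verit) abs_ge_zero div_by_1 frac_le)
        from mult_right_mono[OF this, of "\<bar>\<psi> x\<bar>"]
        show "norm (?B n x) \<le> \<bar>g x $ i * \<psi> x\<bar>"
          by (simp add: abs_mult del: of_nat_Suc)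
      qed
    qed (use int(1) in simp_all)
    have "(\<lambda>n. - (LINT x|?M. ?B n x)) \<longlonglongrightarrow> (LINT x|?M. 0)"
      using A unfolding AB .
    from LIMSEQ_unique[OF this tendsto_minus[OF B]]
    have "(LINT x|?M. (if w x = 0 then g x $ i else 0) * \<psi> x) = 0" by simp
    then show "(LINT x:V|lebesgue. (if w x = 0 then g x $ i else 0) * \<psi> x) = 0"
      by (simp only: test_fun_set_integral[OF \<psi>])
  qed
  have "AE x in lebesgue. \<forall>i\<in>UNIV. x \<in> V \<longrightarrow> (g x $ i * z x + w x * dz x $ i) - (g x $ i * w x + w x * g x $ i) = 0"
    using AE1 by (subst AE_ball_countable) auto
  moreover have "AE x in lebesgue. \<forall>i\<in>UNIV. x \<in> V \<longrightarrow> (if w x = 0 then g x $ i else 0) = 0"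
    using AE2 by (subst AE_ball_countable) auto
  ultimately show ?thesis
  proof eventually_elim
    case (elim x)
    show ?case
    proof
      assume x: "x \<in> V"
      show "g x = (if z x > 0 then dz x else 0)"
      proof (cases "z x > 0")
        case True
        then have "g x $ i = dz x $ i" for i
          using elim(1) x by (auto simp: w_def max_def algebra_simps)
        with True show ?thesis by (simp add: vec_eq_iff)
      next
        case False
        then have "w x = 0" by (simp add: w_def)
        with elim(2) x False show ?thesis by (simp add: vec_eq_iff)
      qed
    qed
  qed
qed

section \<open>Monotonicity of the degenerate vector field\<close>

lemma Hg_eq: "Hg \<gamma> \<xi> = ((max (norm \<xi> - 1) 0 powr \<gamma>) / norm \<xi>) *\<^sub>R \<xi>"
  by (simp add: Hg_def divide_inverse)

text \<open>With a = |\<xi>|, b = |\<eta>| and \<open>h\<close> the radial profile, the product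
  splits as (h a - h b)(a - b) + (h a / a + h b / b)(a b - inner \<xi> \<eta>), nonnegative by
  monotonicity of \<open>h\<close> and by Cauchy-Schwarz. If it vanishes and a > 1, strict growth of
  \<open>h\<close> beyond 1 forces a = b, and the positive coefficient forces equality in
  Cauchy-Schwarz, so \<xi> = \<eta>. If a \<le> 1, the field vanishes at \<xi>. The second claim is
  the conclusion common to both cases.\<close>

lemma Hg_monotone:
  fixes \<xi> \<eta> :: "real^'n"
  assumes "\<gamma> > 0"
  shows "0 \<le> inner (Hg \<gamma> \<xi> - Hg \<gamma> \<eta>) (\<xi> - \<eta>)"
    and "inner (Hg \<gamma> \<xi> - Hg \<gamma> \<eta>) (\<xi> - \<eta>) = 0 \<Longrightarrow> inner (Hg \<gamma> \<xi>) (\<xi> - \<eta>) = 0"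
proof -
  define h where "h t = max (t - 1) 0 powr \<gamma>" for t :: real
  define a where "a = norm \<xi>"
  define b where "b = norm \<eta>"
  have ab: "a \<ge> 0" "b \<ge> 0" by (auto simp: a_def b_def)
  have h_mono: "h s \<le> h t" if "s \<le> t" for s t
    unfolding h_def using that assms by (intro powr_mono2) auto
  have h_strict: "h s < h t" if "s < t" "t > 1" for s t
    unfolding h_def using that assms by (intro powr_less_mono2) auto
  have h0: "h t \<ge> 0" for t by (simp add: h_def)
  have H: "Hg \<gamma> \<xi> = (h a / a) *\<^sub>R \<xi>" "Hg \<gamma> \<eta> = (h b / b) *\<^sub>R \<eta>"
    by (simp_all add: Hg_eq h_def a_def b_def)
  have sq: "inner \<xi> \<xi> = a * a" "inner \<eta> \<eta> = b * b"
    by (simp_all add: a_def b_def dot_square_norm power2_eq_square)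
  have z: "h a / a * (a * a) = h a * a" "h b / b * (b * b) = h b * b" by auto
  have eq: "inner (Hg \<gamma> \<xi> - Hg \<gamma> \<eta>) (\<xi> - \<eta>) =
      h a / a * (a * a) + h b / b * (b * b) - (h a / a + h b / b) * inner \<xi> \<eta>"
    unfolding H by (simp add: inner_diff_left inner_diff_right sq inner_commute[of \<eta> \<xi>] distrib_right)
  \<comment> \<open>Holds at a = 0 as well, since h 0 = 0 and division by zero yields 0.\<close>
  have zb: "h a / a * (a * b) = h a * b" "h b / b * (a * b) = h b * a"
    by (auto simp: h_def)
  have dec: "inner (Hg \<gamma> \<xi> - Hg \<gamma> \<eta>) (\<xi> - \<eta>) =
      (h a - h b) * (a - b) + (h a / a + h b / b) * (a * b - inner \<xi> \<eta>)"
    unfolding eq z by (simp only: right_diff_distrib distrib_right zb) (simp add: algebra_simps)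
  have n1: "0 \<le> (h a - h b) * (a - b)"
    using h_mono[of a b] h_mono[of b a] by (cases "a \<le> b") (auto intro: mult_nonneg_nonneg mult_nonpos_nonpos)
  have cs: "inner \<xi> \<eta> \<le> a * b"
    unfolding a_def b_def by (rule norm_cauchy_schwarz)
  have n2: "0 \<le> (h a / a + h b / b) * (a * b - inner \<xi> \<eta>)"
    using cs ab h0[of a] h0[of b] by (intro mult_nonneg_nonneg add_nonneg_nonneg divide_nonneg_nonneg) auto
  show "0 \<le> inner (Hg \<gamma> \<xi> - Hg \<gamma> \<eta>) (\<xi> - \<eta>)"
    unfolding dec using n1 n2 by simp
  assume "inner (Hg \<gamma> \<xi> - Hg \<gamma> \<eta>) (\<xi> - \<eta>) = 0"
  then have e1: "(h a - h b) * (a - b) = 0" and e2: "(h a / a + h b / b) * (a * b - inner \<xi> \<eta>) = 0"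
    unfolding dec using n1 n2 by linarith+
  show "inner (Hg \<gamma> \<xi>) (\<xi> - \<eta>) = 0"
  proof (cases "a \<le> 1")
    case True
    then show ?thesis using assms by (simp add: H h_def)
  next
    case False
    then have "a = b"
      using e1 h_strict[of a b] h_strict[of b a] by (cases a b rule: linorder_cases) auto
    have "h a > 0" using False by (simp add: h_def)
    then have "h a / a + h b / b > 0" using False \<open>a = b\<close> by (intro add_pos_pos divide_pos_pos) auto
    with e2 have "inner \<xi> \<eta> = a * b" by simp
    then have "inner (\<xi> - \<eta>) (\<xi> - \<eta>) = 0"
      using sq \<open>a = b\<close> by (simp add: inner_diff_left inner_diff_right inner_commute[of \<eta> \<xi>])
    then show ?thesis by simp
  qed
qed

section \<open>The comparison principle\<close>


lemma W1inf_loc_AE_bounded: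
  assumes "W1inf_loc U w g" "compact K" "K \<subseteq> U"
  obtains C where "C > 0" "AE x in lebesgue_on K. \<bar>w x\<bar> \<le> C \<and> norm (g x) \<le> C"
proof -
  obtain C where C: "AE x in lebesgue. x \<in> K \<longrightarrow> \<bar>w x\<bar> \<le> C \<and> norm (g x) \<le> C"
    using assms unfolding W1inf_loc_def by blast
  have "AE x in lebesgue_on K. \<bar>w x\<bar> \<le> \<bar>C\<bar> + 1 \<and> norm (g x) \<le> \<bar>C\<bar> + 1"
    using C compact_sets_lebesgue[OF assms(2)] by (subst AE_restrict_space_iff) (auto elim!: eventually_mono)
  then show ?thesis using that[of "\<bar>C\<bar> + 1"] by simp
qed

lemma W1inf_loc_square_integrable:
  assumes "W1inf_loc U w g" "compact K" "K \<subseteq> U"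
  shows "square_integrable (lebesgue_on K) w" "square_integrable (lebesgue_on K) (\<lambda>x. g x $ i)"
proof -
  interpret finite_measure "lebesgue_on K" by (rule finite_measure_lebesgue_on_compact[OF assms(2)])
  obtain C where C: "AE x in lebesgue_on K. \<bar>w x\<bar> \<le> C \<and> norm (g x) \<le> C"
    using W1inf_loc_AE_bounded[OF assms] by blast
  have m: "w \<in> borel_measurable (lebesgue_on K)" "g \<in> borel_measurable (lebesgue_on K)"
    using assms compact_sets_lebesgue[OF assms(2)] by (auto simp: W1inf_loc_def intro: measurable_lebesgue_on_subset)
  show "square_integrable (lebesgue_on K) w"
    using m(1) C by (intro square_integrable_bounded[where C=C]) (auto elim: eventually_mono)
  have "AE x in lebesgue_on K. \<bar>g x $ i\<bar> \<le> C"
    using C by eventually_elim (use component_le_norm_cart order_trans in blast)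
  moreover have "(\<lambda>x. g x $ i) \<in> borel_measurable (lebesgue_on K)"
    using m(2) by (rule measurable_compose) simp
  ultimately show "square_integrable (lebesgue_on K) (\<lambda>x. g x $ i)"
    by (intro square_integrable_bounded)
qed

text \<open>Square integrability is asked for only on compact subsets of \<open>V\<close>, so local
  bounds suffice and the case V = \<Omega> is covered too.\<close>

lemma AE_gradient_positive_part_diff:
  assumes "p \<ge> 2" "open V" "V \<subseteq> \<Omega>" "W1inf_loc \<Omega> u Du" "W1inf_loc \<Omega> v Dv"
    and W: "W01p p V (\<lambda>x. max (u x - v x) 0) g"
  shows "AE x in lebesgue. x \<in> V \<longrightarrow> g x = (if u x > v x then Du x - Dv x else 0)"
proof -
  have "weak_grad V u Du" "weak_grad V v Dv"
    using assms(3-5) by (auto simp: W1inf_loc_def intro: weak_grad_subset)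
  then have "weak_grad V (\<lambda>x. u x - v x) (\<lambda>x. Du x - Dv x)"
    by (rule weak_grad_diff)
  moreover have "square_integrable (lebesgue_on K) (\<lambda>x. u x - v x)"
    "square_integrable (lebesgue_on K) (\<lambda>x. (Du x - Dv x) $ i)" if "compact K" "K \<subseteq> V" for K i
  proof -
    have K: "K \<subseteq> \<Omega>" using that assms(3) by simp
    note * = W1inf_loc_square_integrable[OF assms(4) \<open>compact K\<close> K] W1inf_loc_square_integrable[OF assms(5) \<open>compact K\<close> K]
    show "square_integrable (lebesgue_on K) (\<lambda>x. u x - v x)"
      by (intro square_integrable_diff *)
    show "square_integrable (lebesgue_on K) (\<lambda>x. (Du x - Dv x) $ i)"
      unfolding vector_minus_component by (intro square_integrable_diff *)
  qed
  ultimately have "AE x in lebesgue. x \<in> V \<longrightarrow> g x = (if u x - v x > 0 then Du x - Dv x else 0)"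
    by (intro weak_gradient_positive_part[OF W assms(1,2)])
  then show ?thesis by simp
qed

text \<open>The common core of both claims. Integrability is assumed here because it has different
  sources for a compactly contained set and for \<Omega> itself.\<close>

lemma comparison_if_integrable:
  fixes u v :: "real^'n \<Rightarrow> real" and Du Dv g :: "real^'n \<Rightarrow> real^'n"
  assumes p: "p \<ge> 2" and V: "V \<in> sets lebesgue"
    and pos: "\<And>x s. x \<in> V \<Longrightarrow> f x s > 0" and anti: "\<And>x. x \<in> V \<Longrightarrow> antimono (f x)"
    and g: "AE x in lebesgue. x \<in> V \<longrightarrow> g x = (if u x > v x then Du x - Dv x else 0)"
    and int: "set_integrable lebesgue V (\<lambda>x. inner (Hg (p - 1) (Du x)) (g x))"
      "set_integrable lebesgue V (\<lambda>x. inner (Hg (p - 1) (Dv x)) (g x))"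
      "set_integrable lebesgue V (\<lambda>x. f x (u x) * max (u x - v x) 0)"
      "set_integrable lebesgue V (\<lambda>x. f x (v x) * max (u x - v x) 0)"
    and eq: "(LINT x:V|lebesgue. inner (Hg (p - 1) (Du x)) (g x)) = (LINT x:V|lebesgue. f x (u x) * max (u x - v x) 0)"
      "(LINT x:V|lebesgue. inner (Hg (p - 1) (Dv x)) (g x)) = (LINT x:V|lebesgue. f x (v x) * max (u x - v x) 0)"
  shows "AE x in lebesgue. x \<in> V \<longrightarrow> u x \<le> v x"
proof -
  let ?M = "lebesgue_on V"
  let ?w = "\<lambda>x. max (u x - v x) 0"
  let ?H = "\<lambda>x. Hg (p - 1) (Du x)" and ?H' = "\<lambda>x. Hg (p - 1) (Dv x)"
  have L: "(LINT x:V|lebesgue. h x) = (LINT x|?M. h x)" for h :: "real^'n \<Rightarrow> real"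
    using V by (simp add: set_lebesgue_integral_def integral_restrict_space)
  note int = int[unfolded set_integrable_iff_lebesgue_on[OF V]] and eq = eq[unfolded L]
  have g': "AE x in ?M. g x = (if u x > v x then Du x - Dv x else 0)"
    using g V by (subst AE_restrict_space_iff) auto
  have nn: "AE x in ?M. 0 \<le> inner (?H x - ?H' x) (g x)"
    using g' by eventually_elim (use Hg_monotone(1)[of "p - 1"] p in auto)
  have intd: "integrable ?M (\<lambda>x. inner (?H x - ?H' x) (g x))"
    unfolding inner_diff_left using int by simp
  have "(LINT x|?M. inner (?H x - ?H' x) (g x)) = (LINT x|?M. f x (u x) * ?w x - f x (v x) * ?w x)"
    unfolding inner_diff_left using int eq by simp
  also have "\<dots> \<le> (LINT x|?M. 0)"
  proof (rule integral_mono)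
    fix x assume "x \<in> space ?M"
    then have "x \<in> V" by simp
    \<comment> \<open>Only points with u > v matter: there \<open>antimono\<close> compares the two
      values of \<open>f\<close>, and elsewhere \<open>?w\<close> is 0.\<close>
    show "f x (u x) * ?w x - f x (v x) * ?w x \<le> 0"
    proof (cases "u x \<le> v x")
      case False
      then have "f x (u x) \<le> f x (v x)"
        using antimonoD[OF anti[OF \<open>x \<in> V\<close>], of "v x" "u x"] by simp
      then show ?thesis by (simp add: mult_right_mono)
    qed simp
  qed (use int in auto)
  finally have "(LINT x|?M. inner (?H x - ?H' x) (g x)) = 0"
    using integral_nonneg_AE[OF nn] by simp
  then have "AE x in ?M. inner (?H x - ?H' x) (g x) = 0"
    using integral_nonneg_eq_0_iff_AE[OF intd nn] by simp
  with g' have "AE x in ?M. inner (?H x) (g x) = 0"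
    by eventually_elim (use Hg_monotone(2)[of "p - 1"] p in auto)
  then have "(LINT x|?M. inner (?H x) (g x)) = 0"
    using int(1) by (subst integral_cong_AE[where g="\<lambda>_. 0"]) auto
  with eq(1) have "(LINT x|?M. f x (u x) * ?w x) = 0" by simp
  moreover have "AE x in ?M. 0 \<le> f x (u x) * ?w x"
    using pos by (intro AE_I2 mult_nonneg_nonneg) (auto intro: less_imp_le)
  ultimately have "AE x in ?M. f x (u x) * ?w x = 0"
    using integral_nonneg_eq_0_iff_AE[OF int(3)] by blast
  then have "AE x in lebesgue. x \<in> V \<longrightarrow> f x (u x) * ?w x = 0"
    using V by (subst (asm) AE_restrict_space_iff) auto
  then show ?thesis
  proof eventually_elim
    case (elim x)
    show ?case
    proof
      assume "x \<in> V"
      with elim pos[of x "u x"] have "?w x = 0" by auto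
      then show "u x \<le> v x" by simp
    qed
  qed
qed

section \<open>Integrability of the weak form on compactly contained sets\<close>

lemma F1F2_continuous_on:
  assumes "open \<Omega>" "F1F2 \<Omega> f"
  shows "continuous_on (\<Omega> \<times> UNIV) (\<lambda>y. f (fst y) (snd y))"
proof (rule continuous_at_imp_continuous_on, rule ballI)
  fix y0 assume "y0 \<in> \<Omega> \<times> (UNIV :: real set)"
  then obtain x0 s0 where y0: "y0 = (x0, s0)" and "x0 \<in> \<Omega>" by auto
  obtain r where r: "r > 0" "cball x0 r \<subseteq> \<Omega>"
    using \<open>open \<Omega>\<close> \<open>x0 \<in> \<Omega>\<close> open_contains_cball by blast
  then have "cpt_sub (ball x0 r) \<Omega>" by (simp add: cpt_sub_def)
  \<comment> \<open>The bound |s0| + 1 admits every s within distance 1 of s0. Joint continuity then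
    follows by moving s to s0 at fixed x with (F1), and x to x0 at fixed s0 with (F2).\<close>
  then obtain L M where LM: "\<forall>x\<in>ball x0 r. \<forall>y\<in>ball x0 r. \<forall>s t. \<bar>s\<bar> \<le> \<bar>s0\<bar> + 1 \<and> \<bar>t\<bar> \<le> \<bar>s0\<bar> + 1 \<longrightarrow>
      \<bar>f x s - f x t\<bar> \<le> L * \<bar>s - t\<bar> \<and> \<bar>f x s - f y s\<bar> \<le> M * norm (x - y)"
  proof -
    have "open (ball x0 r) \<and> cpt_sub (ball x0 r) \<Omega> \<and> \<bar>s0\<bar> + 1 > 0"
      using \<open>cpt_sub (ball x0 r) \<Omega>\<close> by auto
    then show ?thesis
      using \<open>F1F2 \<Omega> f\<close> that unfolding F1F2_def by blast
  qed
  have "((\<lambda>y. f (fst y) (snd y) - f x0 s0) \<longlongrightarrow> 0) (at y0)"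
  proof (rule Lim_null_comparison)
    have "eventually (\<lambda>y. y \<in> ball x0 r \<times> ball s0 1) (at y0)"
      using r(1) by (intro eventually_at_in_open') (auto simp: y0 open_Times)
    then show "\<forall>\<^sub>F y in at y0. norm (f (fst y) (snd y) - f x0 s0) \<le> L * \<bar>snd y - s0\<bar> + M * norm (fst y - x0)"
    proof eventually_elim
      case (elim y)
      then have x: "fst y \<in> ball x0 r" and s: "\<bar>snd y\<bar> \<le> \<bar>s0\<bar> + 1"
        by (auto simp: mem_Times_iff dist_real_def)
      have "x0 \<in> ball x0 r" using r(1) by simp
      then have "\<bar>f (fst y) (snd y) - f (fst y) s0\<bar> \<le> L * \<bar>snd y - s0\<bar>" "\<bar>f (fst y) s0 - f x0 s0\<bar> \<le> M * norm (fst y - x0)"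
        using LM x s by auto
      then show ?case by simp
    qed
    have "((\<lambda>y. L * \<bar>snd y - s0\<bar> + M * norm (fst y - x0)) \<longlongrightarrow> L * \<bar>snd y0 - s0\<bar> + M * norm (fst y0 - x0)) (at y0)"
      by (intro tendsto_intros)
    then show "((\<lambda>y. L * \<bar>snd y - s0\<bar> + M * norm (fst y - x0)) \<longlongrightarrow> 0) (at y0)" by (simp add: y0)
  qed
  then show "isCont (\<lambda>y. f (fst y) (snd y)) y0"
    by (simp add: continuous_at y0 LIM_zero_iff)
qed

text \<open>Composition needs a Borel outer function, as \<open>u\<close> is only Lebesgue
  measurable. Joint continuity of \<open>f\<close> on the open set \<Omega> \<times> R, extended by
  0, provides one.\<close>

lemma F1F2_superposition_measurable:
  fixes u :: "real^'n \<Rightarrow> real"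
  assumes "open \<Omega>" "F1F2 \<Omega> f" "V \<subseteq> \<Omega>" "u \<in> borel_measurable (lebesgue_on V)"
  shows "(\<lambda>x. f x (u x)) \<in> borel_measurable (lebesgue_on V)"
proof -
  have "(\<lambda>y. indicator (\<Omega> \<times> UNIV) y *\<^sub>R f (fst y) (snd y)) \<in> borel_measurable borel"
    using F1F2_continuous_on[OF assms(1,2)] assms(1)
    by (intro borel_measurable_continuous_on_indicator) (auto intro: borel_open open_Times)
  moreover have "(\<lambda>x. x) \<in> borel_measurable (lebesgue_on V)"
    using id_borel_measurable_lebesgue_on by (simp add: id_def)
  then have "(\<lambda>x. (x, u x)) \<in> borel_measurable (lebesgue_on V)"
    using assms(4) by (rule borel_measurable_Pair)
  ultimately have "(\<lambda>x. indicator (\<Omega> \<times> UNIV) (x, u x) *\<^sub>R f (fst (x, u x)) (snd (x, u x))) \<in> borel_measurable (lebesgue_on V)"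
    by (rule measurable_compose[rotated])
  then show ?thesis
    by (rule measurable_cong[THEN iffD1, rotated]) (use assms(3) in \<open>auto simp: indicator_def\<close>)
qed

lemma Hg_measurable: "Hg \<gamma> \<in> borel_measurable (borel :: (real^'n) measure)"
  unfolding Hg_eq[abs_def] by measurable

lemma norm_Hg_le:
  assumes "\<gamma> > 0" "norm \<xi> \<le> C"
  shows "norm (Hg \<gamma> \<xi>) \<le> max (C - 1) 0 powr \<gamma>"
proof -
  have "norm (Hg \<gamma> \<xi>) \<le> max (norm \<xi> - 1) 0 powr \<gamma>" by (simp add: Hg_eq)
  also have "\<dots> \<le> max (C - 1) 0 powr \<gamma>" using assms by (intro powr_mono2) auto
  finally show ?thesis .
qed

text \<open>On a finite measure space |b| \<le> 1 + |b|^p replaces Hoelder's inequality. The inner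
  product on the reals is multiplication, so the lemma serves both sides of the weak
  equation.\<close>

lemma integrable_bounded_inner_powr:
  fixes a b :: "'a \<Rightarrow> 'b::euclidean_space"
  assumes "finite_measure M" "p \<ge> 1" "a \<in> borel_measurable M" "b \<in> borel_measurable M"
    and "AE x in M. norm (a x) \<le> B" "integrable M (\<lambda>x. norm (b x) powr p)"
  shows "integrable M (\<lambda>x. inner (a x) (b x))"
proof (rule Bochner_Integration.integrable_bound)
  interpret finite_measure M by fact
  show "integrable M (\<lambda>x. B * (1 + norm (b x) powr p))" using assms(6) by simp
  show "AE x in M. norm (inner (a x) (b x)) \<le> norm (B * (1 + norm (b x) powr p))"
    using assms(5)
  proof eventually_elim
    case (elim x)
    then have "B \<ge> 0" using norm_ge_zero order_trans by blast
    have "norm (b x) \<le> 1 + norm (b x) powr p"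
    proof (cases "norm (b x) \<le> 1")
      case False
      then have "norm (b x) powr 1 \<le> norm (b x) powr p" using assms(2) by (intro powr_mono) auto
      with False show ?thesis by simp
    qed (simp add: add_increasing2)
    with elim \<open>B \<ge> 0\<close> have "norm (a x) * norm (b x) \<le> B * (1 + norm (b x) powr p)"
      by (intro mult_mono) auto
    then show ?case
      using Cauchy_Schwarz_ineq2[of "a x" "b x"] by (simp add: abs_if)
  qed
  show "(\<lambda>x. inner (a x) (b x)) \<in> borel_measurable M" using assms(3,4) by (rule borel_measurable_inner)
qed

text \<open>\<open>loc_weak_sol\<close> only equates integrals, so integrability is supplied here.
  On the compact closure of \<open>V\<close> the bounds on \<open>u\<close> and \<open>Du\<close>
  make the coefficients \<open>Hg (p - 1) (Du x)\<close> and \<open>f x (u x)\<close> essentially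
  bounded, and \<open>g\<close> and \<open>w\<close> lie in L^p over a set of finite
  measure.\<close>

lemma bounded_weak_form_integrable:
  fixes u w :: "real^'n \<Rightarrow> real"
  assumes "open \<Omega>" "p \<ge> 2" "F1F2 \<Omega> f" "open V" "cpt_sub V \<Omega>" "W1inf_loc \<Omega> u Du" "W01p p V w g"
  shows "set_integrable lebesgue V (\<lambda>x. inner (Hg (p - 1) (Du x)) (g x))"
    and "set_integrable lebesgue V (\<lambda>x. f x (u x) * w x)"
proof -
  let ?K = "closure V" and ?M = "lebesgue_on V"
  have K: "compact ?K" "?K \<subseteq> \<Omega>" "V \<subseteq> \<Omega>"
    using assms(5) closure_subset by (auto simp: cpt_sub_def)
  have V: "V \<in> sets lebesgue" using assms(4) by auto
  have "bounded V" using K(1) compact_imp_bounded bounded_subset closure_subset by blast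
  then have "V \<in> lmeasurable" using assms(4) by (rule lmeasurable_open)
  then have fin: "finite_measure ?M" by (rule finite_measure_lebesgue_on)
  obtain C where C: "C > 0" "AE x in lebesgue_on ?K. \<bar>u x\<bar> \<le> C \<and> norm (Du x) \<le> C"
    by (rule W1inf_loc_AE_bounded[OF assms(6) K(1,2)])
  have CV: "AE x in ?M. \<bar>u x\<bar> \<le> C \<and> norm (Du x) \<le> C"
  proof -
    have "AE x in lebesgue. x \<in> ?K \<longrightarrow> \<bar>u x\<bar> \<le> C \<and> norm (Du x) \<le> C"
      using C(2) compact_sets_lebesgue[OF K(1)] by (subst (asm) AE_restrict_space_iff) auto
    then show ?thesis
      using V closure_subset[of V] by (subst AE_restrict_space_iff) (auto elim!: eventually_mono)
  qed
  have m: "u \<in> borel_measurable ?M" "Du \<in> borel_measurable ?M"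
    using assms(6) V K(3) by (auto simp: W1inf_loc_def intro: measurable_lebesgue_on_subset)
  have W: "set_borel_measurable lebesgue V w" "set_borel_measurable lebesgue V g"
    "set_integrable lebesgue V (\<lambda>x. \<bar>w x\<bar> powr p)" "set_integrable lebesgue V (\<lambda>x. norm (g x) powr p)"
    using assms(7) by (auto simp: W01p_def W1p_def Lp_on_def)
  have mW: "w \<in> borel_measurable ?M" "g \<in> borel_measurable ?M"
    using measurable_lebesgue_on_subset[OF _ V] W(1,2) by blast+
  have "integrable ?M (\<lambda>x. inner (Hg (p - 1) (Du x)) (g x))"
  proof (rule integrable_bounded_inner_powr[OF fin])
    show "AE x in ?M. norm (Hg (p - 1) (Du x)) \<le> max (C - 1) 0 powr (p - 1)"
      using CV by eventually_elim (use assms(2) in \<open>auto intro: norm_Hg_le\<close>)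
    show "integrable ?M (\<lambda>x. norm (g x) powr p)"
      using W(4) by (simp add: set_integrable_iff_lebesgue_on[OF V])
  qed (use assms(2) mW measurable_compose[OF m(2) Hg_measurable] in auto)
  then show "set_integrable lebesgue V (\<lambda>x. inner (Hg (p - 1) (Du x)) (g x))"
    by (simp add: set_integrable_iff_lebesgue_on[OF V])
  \<comment> \<open>\<open>u\<close> takes almost all its values in [-C, C], so continuity of
    \<open>f\<close> on this compact product bounds the right-hand side of the equation.\<close>
  have "bounded ((\<lambda>y. f (fst y) (snd y)) ` (?K \<times> {-C..C}))"
    using K by (intro compact_imp_bounded compact_continuous_image compact_Times
        continuous_on_subset[OF F1F2_continuous_on[OF assms(1,3)]]) auto
  then obtain B where B: "\<And>x s. x \<in> ?K \<Longrightarrow> \<bar>s\<bar> \<le> C \<Longrightarrow> \<bar>f x s\<bar> \<le> B"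
    unfolding bounded_iff by (force simp: abs_le_iff)
  have "integrable ?M (\<lambda>x. inner (f x (u x)) (w x))"
  proof (rule integrable_bounded_inner_powr[OF fin])
    have "AE x in ?M. x \<in> V" by (rule AE_I2) simp
    with CV show "AE x in ?M. norm (f x (u x)) \<le> B"
      by eventually_elim (use B closure_subset in auto)
    show "integrable ?M (\<lambda>x. norm (w x) powr p)"
      using W(3) by (simp add: set_integrable_iff_lebesgue_on[OF V])
  qed (use assms(2) mW F1F2_superposition_measurable[OF assms(1,3) K(3) m(1)] in auto)
  then show "set_integrable lebesgue V (\<lambda>x. f x (u x) * w x)"
    by (simp add: set_integrable_iff_lebesgue_on[OF V])
qed

theorem theorem5p2:
  fixes \<Omega> :: "(real^'n) set" and p :: real
    and f :: "real^'n \<Rightarrow> real \<Rightarrow> real"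
    and u v :: "real^'n \<Rightarrow> real" and Du Dv :: "real^'n \<Rightarrow> real^'n"
  assumes "open \<Omega>" and "CARD('n) \<ge> 2" and "p \<ge> 2"
    and "\<forall>x\<in>\<Omega>. \<forall>s. f x s > 0"
    and "F1F2 \<Omega> f"
    and "\<forall>x\<in>\<Omega>. antimono (f x)"
    and "W1inf_loc \<Omega> u Du" and "W1inf_loc \<Omega> v Dv"
    and "loc_weak_sol p \<Omega> f u Du" and "loc_weak_sol p \<Omega> f v Dv"
  shows "(\<forall>\<Omega>'. open \<Omega>' \<and> cpt_sub \<Omega>' \<Omega> \<and>
             (\<exists>g. W01p p \<Omega>' (\<lambda>x. max (u x - v x) 0) g) \<longrightarrow>
             (AE x in lebesgue. x \<in> \<Omega>' \<longrightarrow> u x \<le> v x))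
       \<and> ((\<exists>C. compact C \<and> C \<subseteq> \<Omega> \<and> {x\<in>\<Omega>. norm (Du x) \<le> 1} \<subseteq> C) \<and>
           (\<exists>g. W01p p \<Omega> (\<lambda>x. max (u x - v x) 0) g) \<and>
           glob_weak_sol p \<Omega> f u Du \<and> glob_weak_sol p \<Omega> f v Dv \<longrightarrow>
           (AE x in lebesgue. x \<in> \<Omega> \<longrightarrow> u x \<le> v x))"
proof (rule conjI; intro allI impI; elim conjE exE)
  fix V g
  assume V: "open V" "cpt_sub V \<Omega>" and W: "W01p p V (\<lambda>x. max (u x - v x) 0) g"
  have sub: "V \<subseteq> \<Omega>" using V(2) closure_subset by (auto simp: cpt_sub_def)
  show "AE x in lebesgue. x \<in> V \<longrightarrow> u x \<le> v x"
  proof (rule comparison_if_integrable)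
    show "AE x in lebesgue. x \<in> V \<longrightarrow> g x = (if u x > v x then Du x - Dv x else 0)"
      by (rule AE_gradient_positive_part_diff[OF assms(3) V(1) sub assms(7,8) W])
    show "f x s > 0" "antimono (f x)" if "x \<in> V" for x s
      using assms(4,6) sub that by auto
    show "(LINT x:V|lebesgue. inner (Hg (p - 1) (Du x)) (g x)) = (LINT x:V|lebesgue. f x (u x) * max (u x - v x) 0)"
      "(LINT x:V|lebesgue. inner (Hg (p - 1) (Dv x)) (g x)) = (LINT x:V|lebesgue. f x (v x) * max (u x - v x) 0)"
      using assms(9,10) V W unfolding loc_weak_sol_def by blast+
  qed (use V(1) assms(3) bounded_weak_form_integrable[OF assms(1,3,5) V assms(7) W]
      bounded_weak_form_integrable[OF assms(1,3,5) V assms(8) W] in auto)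
next
  fix g
  assume W: "W01p p \<Omega> (\<lambda>x. max (u x - v x) 0) g"
    and u: "glob_weak_sol p \<Omega> f u Du" and v: "glob_weak_sol p \<Omega> f v Dv"
  show "AE x in lebesgue. x \<in> \<Omega> \<longrightarrow> u x \<le> v x"
  proof (rule comparison_if_integrable)
    show "AE x in lebesgue. x \<in> \<Omega> \<longrightarrow> g x = (if u x > v x then Du x - Dv x else 0)"
      by (rule AE_gradient_positive_part_diff[OF assms(3,1) order_refl assms(7,8) W])
    show "f x s > 0" "antimono (f x)" if "x \<in> \<Omega>" for x s
      using assms(4,6) that by auto
    \<comment> \<open>\<Omega> may have infinite measure and \<open>Du\<close> is bounded only
      locally, so integrability is read off from the global weak formulation instead of being
      derived from bounds.\<close>
    show "set_integrable lebesgue \<Omega> (\<lambda>x. inner (Hg (p - 1) (Du x)) (g x))"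
      "set_integrable lebesgue \<Omega> (\<lambda>x. f x (u x) * max (u x - v x) 0)"
      "(LINT x:\<Omega>|lebesgue. inner (Hg (p - 1) (Du x)) (g x)) = (LINT x:\<Omega>|lebesgue. f x (u x) * max (u x - v x) 0)"
      using u W unfolding glob_weak_sol_def by blast+
    show "set_integrable lebesgue \<Omega> (\<lambda>x. inner (Hg (p - 1) (Dv x)) (g x))"
      "set_integrable lebesgue \<Omega> (\<lambda>x. f x (v x) * max (u x - v x) 0)"
      "(LINT x:\<Omega>|lebesgue. inner (Hg (p - 1) (Dv x)) (g x)) = (LINT x:\<Omega>|lebesgue. f x (v x) * max (u x - v x) 0)"
      using v W unfolding glob_weak_sol_def by blast+
  qed (use assms(1,3) in auto)
qed

end
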